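(* The scheme $$\frac{\phi^{n+1}-\phi^n}{\delta t}-M\Delta w^{n+1}=0,\qquad w^{n+1}=-\epsilon^2\Delta\phi^{n+1}+H^nU^{n+1},\qquad U^{n+1}-U^n=\tfrac12H^n(\phi^{n+1}-\phi^n),$$ with $H^n=H(\phi^n)$ and boundary conditions either (i) $\phi^{n+1},w^{n+1}$ are periodic, or (ii) $\partial_{\boldsymbol n}\phi^{n+1}|_{\partial\Omega}=\partial_{\boldsymbol n}w^{n+1}|_{\partial\Omega}=0$, is unconditionally energy stable in the sense that $$E(\phi^{n+1},U^{n+1})\le E(\phi^n,U^n)-\delta t\,M\|\nabla w^{n+1}\|^2 .$$
   Context: $\Omega\subseteq\mathbb R^d$ ($d=2,3$) is the spatial domain, $\boldsymbol n$ is the normal on $\partial\Omega$, and $\|\cdot\|$ is the $L^2(\Omega)$ norm. $M$ is the (positive) mobility constant, $\epsilon>0$ is an interface parameter, and $\delta t>0$ is the time step size. $F$ is a nonlinear bulk potential bounded from below on its domain of definition: $F(x)>-A$ for some positive constant $A$. $B$ is a positive constant with $B>A$. Put $f=F'$ and $$H(\phi)=\frac{f(\phi)}{\sqrt{F(\phi)+B}} .$$ The scheme is a first-order, semi-discrete (in time) discretization of the Cahn-Hilliard system $\phi_t-M\Delta w=0$, $w=-\epsilon^2\Delta\phi+H(\phi)U$, $U_t=\frac12H(\phi)\phi_t$, where $U=\sqrt{F(\phi)+B}$ initially; $\phi^n,w^n,U^n$ denote the approximations at time $t_n=n\delta t$. The energy is $$E(\phi,U)=\int_\Omega\Big(\frac{\epsilon^2}{2}|\nabla\phi|^2+U^2\Big)\,d\boldsymbol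 x .$$ *)

theory Defs
  imports "HOL-Analysis.Analysis"
begin

section \<open>Differential operators and classical regularity\<close>

definition gradient :: "(real ^ 'n \<Rightarrow> real) \<Rightarrow> real ^ 'n \<Rightarrow> real ^ 'n" where
  "gradient u x = (\<chi> i. frechet_derivative u (at x) (axis i 1))"

definition laplacian :: "(real ^ 'n \<Rightarrow> real) \<Rightarrow> real ^ 'n \<Rightarrow> real" where
  "laplacian u x = (\<Sum>i\<in>UNIV. gradient (\<lambda>y. gradient u y $ i) x $ i)"

text \<open>The classes \<open>C1_on\<close> and \<open>C2_on\<close> are meant for open sets \<open>S\<close> only.\<close>

definition C1_on :: "(real ^ 'n) set \<Rightarrow> (real ^ 'n \<Rightarrow> real) \<Rightarrow> bool" where
  "C1_on S u \<longleftrightarrow> (\<forall>x\<in>S. u differentiable (at x)) \<and> continuous_on S (gradient u)"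

definition C2_on :: "(real ^ 'n) set \<Rightarrow> (real ^ 'n \<Rightarrow> real) \<Rightarrow> bool" where
  "C2_on S u \<longleftrightarrow> C1_on S u \<and> (\<forall>i. C1_on S (\<lambda>x. gradient u x $ i))"

text \<open>The usual space of functions that are continuously differentiable up to the boundary of
  the open set \<open>S\<close>: the function is continuous on the closure, and its gradient on \<open>S\<close> extends
  continuously to the closure.\<close>

definition C1_closure :: "(real ^ 'n) set \<Rightarrow> (real ^ 'n \<Rightarrow> real) \<Rightarrow> bool" where
  "C1_closure S u \<longleftrightarrow> C1_on S u \<and> continuous_on (closure S) u \<and>
     (\<exists>g. continuous_on (closure S) g \<and> (\<forall>x\<in>S. g x = gradient u x))"

section \<open>Domains, normals and boundary conditions\<close>

text \<open>\<open>outer_normal S x \<nu>\<close>: near the boundary point \<open>x\<close> the set \<open>S\<close> lies on one side of the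
  \<open>C\<^sup>1\<close> hypersurface \<open>\<rho> = 0\<close>, and \<open>\<nu>\<close> is the outward unit normal to it at \<open>x\<close>. Boundary
  points where there is no such \<open>\<rho>\<close> (corners, edges) have no outer normal.\<close>

definition outer_normal :: "(real ^ 'n) set \<Rightarrow> real ^ 'n \<Rightarrow> real ^ 'n \<Rightarrow> bool" where
  "outer_normal S x \<nu> \<longleftrightarrow> x \<in> frontier S \<and>
     (\<exists>V \<rho>. open V \<and> x \<in> V \<and> C1_on V \<rho> \<and> (\<forall>y\<in>V. gradient \<rho> y \<noteq> 0) \<and>
        S \<inter> V = {y \<in> V. \<rho> y < 0} \<and> \<nu> = gradient \<rho> x /\<^sub>R norm (gradient \<rho> x))"

definition singular_boundary :: "(real ^ 'n) set \<Rightarrow> (real ^ 'n) set" where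
  "singular_boundary S = {x \<in> frontier S. \<nexists>\<nu>. outer_normal S x \<nu>}"

text \<open>Bounded domains with piecewise \<open>C\<^sup>1\<close> boundary: the singular part of the boundary has
  vanishing Minkowski content in codimension one. This allows every bounded \<open>C\<^sup>1\<close> domain (no
  singular points) as well as boxes, Lipschitz polygons and Lipschitz polyhedra.\<close>

definition piecewise_C1_domain :: "(real ^ 'n) set \<Rightarrow> bool" where
  "piecewise_C1_domain S \<longleftrightarrow> open S \<and> connected S \<and> bounded S \<and>
     ((\<lambda>r. measure lebesgue (\<Union>x\<in>singular_boundary S. ball x r) / r) \<longlongrightarrow> 0) (at_right 0)"

text \<open>The normal derivative at a boundary point is the derivative in direction \<open>\<nu>\<close> taken from
  inside the domain, since functions are only controlled on its closure.\<close>

definition has_normal_derivative ::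
    "(real ^ 'n \<Rightarrow> real) \<Rightarrow> real ^ 'n \<Rightarrow> real ^ 'n \<Rightarrow> real \<Rightarrow> bool" where
  "has_normal_derivative u x \<nu> c \<longleftrightarrow>
     ((\<lambda>t. (u x - u (x - t *\<^sub>R \<nu>)) / t) \<longlongrightarrow> c) (at_right 0)"

definition homogeneous_neumann :: "(real ^ 'n) set \<Rightarrow> (real ^ 'n \<Rightarrow> real) \<Rightarrow> bool" where
  "homogeneous_neumann S u \<longleftrightarrow>
     (\<forall>x \<nu>. outer_normal S x \<nu> \<longrightarrow> has_normal_derivative u x \<nu> 0)"

text \<open>\<open>p $ i\<close> is the period in the \<open>i\<close>-th coordinate direction.\<close>

definition cell_periodic :: "real ^ 'n \<Rightarrow> (real ^ 'n \<Rightarrow> real) \<Rightarrow> bool" where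
  "cell_periodic p u \<longleftrightarrow> (\<forall>x i. u (x + axis i (p $ i)) = u x)"

section \<open>Square integrability, energy and the nonlinearity\<close>

definition L2 :: "(real ^ 'n) set \<Rightarrow> (real ^ 'n \<Rightarrow> real) \<Rightarrow> bool" where
  "L2 S u \<longleftrightarrow> set_borel_measurable lebesgue S u \<and> set_integrable lebesgue S (\<lambda>x. (u x)\<^sup>2)"

definition L2_norm :: "(real ^ 'n) set \<Rightarrow> (real ^ 'n \<Rightarrow> real ^ 'n) \<Rightarrow> real" where
  "L2_norm S g = sqrt (LINT x:S|lebesgue. (norm (g x))\<^sup>2)"

definition energy ::
    "(real ^ 'n) set \<Rightarrow> real \<Rightarrow> (real ^ 'n \<Rightarrow> real) \<Rightarrow> (real ^ 'n \<Rightarrow> real) \<Rightarrow> real" where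
  "energy S \<epsilon> \<phi> U = (LINT x:S|lebesgue. \<epsilon>\<^sup>2 / 2 * (norm (gradient \<phi> x))\<^sup>2 + (U x)\<^sup>2)"

definition H :: "(real \<Rightarrow> real) \<Rightarrow> real \<Rightarrow> real \<Rightarrow> real" where
  "H F B s = deriv F s / sqrt (F s + B)"

end

theory Submission
  imports Defs
begin

text \<open>Test the first equation of the scheme with \<open>w\<close> at the new time, the second with the increment
\<open>d\<close> of \<open>\<phi>\<close>, and the third with twice the new \<open>U\<close>. After integration by parts
\<open>\<integral> w d = - \<delta>t M \<parallel>\<nabla>w\<parallel>\<^sup>2\<close> on the one hand, and on the other hand
\<open>\<integral> w d = \<epsilon>\<^sup>2 \<integral> \<nabla>d \<bullet> \<nabla>\<phi>' + 2 \<integral> U' (U' - U)\<close>, where the prime marks the new time level. The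
identity \<open>2 p \<bullet> (p - q) = |p|\<^sup>2 - |q|\<^sup>2 + |p - q|\<^sup>2\<close> turns the right-hand side into the increment
of the energy plus a nonnegative remainder. This computation is \<open>energy_dissipation\<close>.

It uses only Green's identity \<open>\<integral> v \<Delta>u = - \<integral> \<nabla>v \<bullet> \<nabla>u\<close>, for pairs whose product \<open>v \<Delta>u\<close> is
integrable: \<open>\<Delta>\<phi>'\<close> itself need not be integrable, because \<open>H\<close> may blow up, but the scheme expresses
\<open>d \<Delta>\<phi>'\<close> through products of square integrable functions.

For periodic data Green's identity holds because the integral of a periodic function over a
period cell does not change under translations, so that the integral of its derivative vanishes
(\<open>integral_partial_periodic\<close>).

For Neumann data the field \<open>X = v \<nabla>u\<close> is continuous up to the boundary and its normal component
vanishes at every regular boundary point; \<open>integral_divergence_eq_0\<close> says that its divergence has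
integral zero. The boundary enters through thin layers rather than through a surface measure.
The functional
\<open>flux \<eta> = \<integral> (\<eta> div X + \<nabla>\<eta> \<bullet> X)\<close>, the integral of \<open>div (\<eta> X)\<close>, is additive in \<open>\<eta>\<close> and vanishes

 \<^item> for \<open>\<eta>\<close> with compact support in the domain (translation invariance again);

 \<^item> for \<open>\<eta>\<close> supported near a regular boundary point: multiply \<open>\<eta>\<close> by a cutoff that vanishes in a
  layer of width \<open>1/k\<close> along the boundary. The gradient of the cutoff has size \<open>k\<close> on a set of
  measure \<open>O(1/k)\<close> and is normal to the boundary, where the normal component of \<open>X\<close> tends to zero;

 \<^item> hence, by a finite cover by balls, for every \<open>\<eta>\<close> that vanishes near the singular boundary.

Finally \<open>\<eta>\<close> is chosen equal to 1 except within distance \<open>2r\<close> of the singular boundary, with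
\<open>\<integral> |\<nabla>\<eta>|\<close> bounded by the Minkowski quotient of the singular boundary, which tends to zero
(\<open>small_set_cutoff\<close>). Letting \<open>r \<rightarrow> 0\<close> gives \<open>\<integral> div X = 0\<close>.\<close>

section \<open>Gradients and continuously differentiable functions\<close>

text \<open>The coordinatewise \<open>gradient\<close> represents the Frechet derivative. With this lemma and its
converse \<open>gradient_eq\<close> all calculus rules are inherited from \<open>GDERIV\<close>.\<close>

lemma GDERIV_gradient:
  fixes u :: "real ^ 'n \<Rightarrow> real"
  assumes "u differentiable (at x)"
  shows "GDERIV u x :> gradient u x"
proof -
  let ?D = "frechet_derivative u (at x)"
  have D: "(u has_derivative ?D) (at x)"
    using assms frechet_derivative_works by blast
  then have lin: "linear ?D"
    using has_derivative_linear by blast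
  have "?D h = h \<bullet> gradient u x" for h
  proof -
    have "?D h = ?D (\<Sum>i\<in>UNIV. (h $ i) *\<^sub>R axis i 1)"
      using basis_expansion[of h] by (simp add: scalar_mult_eq_scaleR)
    also have "\<dots> = (\<Sum>i\<in>UNIV. (h $ i) * ?D (axis i 1))"
      by (simp add: linear_sum[OF lin] linear_cmul[OF lin])
    finally show ?thesis
      by (simp add: inner_vec_def gradient_def)
  qed
  then have "?D = (\<lambda>h. h \<bullet> gradient u x)"
    by auto
  with D show ?thesis
    by (simp add: gderiv_def)
qed

lemma gradient_eq:
  fixes u :: "real ^ 'n \<Rightarrow> real"
  assumes "GDERIV u x :> g"
  shows "gradient u x = g"
proof -
  have "frechet_derivative u (at x) = (\<lambda>h. h \<bullet> g)"
    using assms frechet_derivative_at unfolding gderiv_def by metis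
  then show ?thesis
    by (simp add: gradient_def vec_eq_iff inner_axis')
qed

lemma GDERIV_transform_open:
  fixes u :: "real ^ 'n \<Rightarrow> real"
  assumes "GDERIV u x :> g" "open S" "x \<in> S" "\<And>y. y \<in> S \<Longrightarrow> u y = v y"
  shows "GDERIV v x :> g"
  using has_derivative_transform_within_open[of u "\<lambda>h. h \<bullet> g" x UNIV S v] assms
  by (auto simp: gderiv_def)

lemma C1_onI:
  assumes "continuous_on S g" "\<And>x. x \<in> S \<Longrightarrow> GDERIV u x :> g x"
  shows "C1_on S u"
proof -
  have "continuous_on S (gradient u)"
    using assms gradient_eq continuous_on_cong by metis
  moreover have "u differentiable (at x)" if "x \<in> S" for x
    using assms(2)[OF that] by (auto simp: gderiv_def differentiable_def)
  ultimately show ?thesis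
    by (simp add: C1_on_def)
qed

lemma C1_on_GDERIV: "C1_on S u \<Longrightarrow> x \<in> S \<Longrightarrow> GDERIV u x :> gradient u x"
  by (simp add: C1_on_def GDERIV_gradient)

lemma C1_on_continuous_gradient: "C1_on S u \<Longrightarrow> continuous_on S (gradient u)"
  by (simp add: C1_on_def)

lemma C1_on_continuous: "C1_on S u \<Longrightarrow> continuous_on S u"
  by (simp add: C1_on_def differentiable_imp_continuous_within differentiable_on_def
      continuous_at_imp_continuous_on)

lemma C1_on_subset: "C1_on T u \<Longrightarrow> S \<subseteq> T \<Longrightarrow> C1_on S u"
  by (auto simp: C1_on_def intro: continuous_on_subset)

lemma C1_on_const: "C1_on S (\<lambda>x. c)"
  by (rule C1_onI[where g = "\<lambda>x. 0"]) (auto intro: GDERIV_const)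

lemma C1_on_diff: "C1_on S u \<Longrightarrow> C1_on S v \<Longrightarrow> C1_on S (\<lambda>x. u x - v x)"
  by (rule C1_onI[where g = "\<lambda>x. gradient u x - gradient v x"])
     (auto intro!: GDERIV_diff C1_on_GDERIV continuous_intros C1_on_continuous_gradient)

lemma C1_on_mult: "C1_on S u \<Longrightarrow> C1_on S v \<Longrightarrow> C1_on S (\<lambda>x. u x * v x)"
  by (rule C1_onI[where g = "\<lambda>x. u x *\<^sub>R gradient v x + v x *\<^sub>R gradient u x"])
     (auto intro!: GDERIV_mult C1_on_GDERIV continuous_intros C1_on_continuous_gradient
        C1_on_continuous)

lemma C1_on_prod:
  assumes "\<And>c. c \<in> T \<Longrightarrow> C1_on S (u c)"
  shows "C1_on S (\<lambda>x. \<Prod>c\<in>T. u c x)"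
  using assms
  by (induction T rule: infinite_finite_induct) (auto intro: C1_on_const C1_on_mult)

lemma C1_on_compose:
  assumes "C1_on S u" "\<And>t. DERIV g t :> g' t" "continuous_on UNIV g'"
  shows "C1_on S (\<lambda>x. g (u x))"
proof (rule C1_onI[where g = "\<lambda>x. g' (u x) *\<^sub>R gradient u x"])
  show "continuous_on S (\<lambda>x. g' (u x) *\<^sub>R gradient u x)"
    using assms(1) by (intro continuous_intros C1_on_continuous_gradient C1_on_continuous
        continuous_on_compose2[OF assms(3)]) auto
  show "GDERIV (\<lambda>x. g (u x)) x :> g' (u x) *\<^sub>R gradient u x" if "x \<in> S" for x
    using assms that by (intro GDERIV_DERIV_compose C1_on_GDERIV)
qed

lemma gradient_mult:
  assumes "C1_on S u" "C1_on S v" "x \<in> S"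
  shows "gradient (\<lambda>x. u x * v x) x = u x *\<^sub>R gradient v x + v x *\<^sub>R gradient u x"
  using assms by (intro gradient_eq GDERIV_mult C1_on_GDERIV)

lemma gradient_diff:
  assumes "C1_on S u" "C1_on S v" "x \<in> S"
  shows "gradient (\<lambda>x. u x - v x) x = gradient u x - gradient v x"
  using assms by (intro gradient_eq GDERIV_diff C1_on_GDERIV)

lemma gradient_compose:
  assumes "C1_on S u" "DERIV g (u x) :> d" "x \<in> S"
  shows "gradient (\<lambda>x. g (u x)) x = d *\<^sub>R gradient u x"
  using assms by (intro gradient_eq GDERIV_DERIV_compose C1_on_GDERIV)

lemma gradient_zero_open:
  fixes Y :: "real ^ 'n \<Rightarrow> real"
  assumes "open S" "x \<in> S" "\<And>y. y \<in> S \<Longrightarrow> Y y = 0"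
  shows "gradient Y x = 0"
  using GDERIV_transform_open[OF GDERIV_const[of 0 x] assms(1,2), of Y] assms(3) gradient_eq
  by auto

text \<open>The complement of \<open>K\<close> is open and \<open>Y\<close> vanishes there, so the two open sets \<open>S\<close> and \<open>- K\<close>
cover the space and \<open>Y\<close> is continuously differentiable on each. The values of the factors of a
product \<open>Y\<close> outside \<open>S\<close> are thus irrelevant as long as one of them is a cutoff.\<close>

lemma C1_on_extend_zero:
  fixes Y :: "real ^ 'n \<Rightarrow> real"
  assumes "open S" "closed K" "K \<subseteq> S" "C1_on S Y" "\<And>x. x \<notin> K \<Longrightarrow> Y x = 0"
  shows "C1_on UNIV Y"
proof -
  have opK: "open (- K)"
    using assms by auto
  have G0: "GDERIV Y x :> 0" if "x \<in> - K" for x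
    using GDERIV_transform_open[OF GDERIV_const[of 0 x] opK that, of Y] assms(5) by auto
  have "continuous_on (- K) (gradient Y)"
    using continuous_on_const[of "- K" 0] G0 gradient_eq continuous_on_cong by metis
  then have "continuous_on (S \<union> - K) (gradient Y)"
    using continuous_on_open_Un[OF \<open>open S\<close> opK] C1_on_continuous_gradient[OF assms(4)] by blast
  moreover have "S \<union> - K = UNIV"
    using assms by auto
  moreover have "GDERIV Y x :> gradient Y x" for x
  proof (cases "x \<in> K")
    case True
    then show ?thesis using assms C1_on_GDERIV by blast
  next
    case False
    then show ?thesis using G0[of x] gradient_eq by force
  qed
  ultimately show ?thesis
    by (intro C1_onI[where g = "gradient Y"]) auto
qed

section \<open>Vanishing integrals of partial derivatives\<close>

text \<open>The function \<open>J t = \<integral> Y (x + t e\<^sub>i) dx\<close> is constant near \<open>0\<close> by assumption, while its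
derivative at \<open>0\<close> is the integral of the partial derivative. Both integrations by parts below,
for compact support and for periodic functions, are instances.\<close>

lemma integral_partial_eq_0_if_translation_invariant:
  fixes Y :: "real ^ 'n \<Rightarrow> real"
  assumes C1: "C1_on UNIV Y" and p: "p > 0"
    and inv: "\<And>t. 0 \<le> t \<Longrightarrow> t \<le> p \<Longrightarrow>
      integral (cbox (a + t *\<^sub>R axis i 1) (b + t *\<^sub>R axis i 1)) Y = integral (cbox a b) Y"
  shows "integral (cbox a b) (\<lambda>x. gradient Y x $ i) = 0"
proof -
  let ?e = "axis i 1 :: real ^ 'n"
  let ?J = "\<lambda>t. integral (cbox a b) (\<lambda>x. Y (x + t *\<^sub>R ?e))"
  have contY: "continuous_on UNIV Y" and contG: "continuous_on UNIV (gradient Y)"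
    using C1 C1_on_continuous C1_on_continuous_gradient by auto
  have J: "?J t = integral (cbox a b) Y" if "t \<in> {0..p}" for t
    using that inv[of t]
      integral_shift_cbox[of "a + t *\<^sub>R ?e" "t *\<^sub>R ?e" "b + t *\<^sub>R ?e" Y] by simp
  have "(?J has_field_derivative integral (cbox a b) (\<lambda>x. gradient Y (x + 0 *\<^sub>R ?e) $ i))
      (at 0 within {0..p})"
  proof (rule leibniz_rule_field_derivative)
    fix t x assume "t \<in> {0..p}" "x \<in> cbox a b"
    have "((\<lambda>t. Y (x + t *\<^sub>R ?e)) has_derivative (\<lambda>h. (h *\<^sub>R ?e) \<bullet> gradient Y (x + t *\<^sub>R ?e)))
        (at t within {0..p})"
    proof (rule has_derivative_compose[where g = Y and f = "\<lambda>t. x + t *\<^sub>R ?e"])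
      show "((\<lambda>t. x + t *\<^sub>R ?e) has_derivative (\<lambda>h. h *\<^sub>R ?e)) (at t within {0..p})"
        by (auto intro!: derivative_eq_intros)
      show "(Y has_derivative (\<lambda>h. h \<bullet> gradient Y (x + t *\<^sub>R ?e))) (at (x + t *\<^sub>R ?e))"
        using C1_on_GDERIV[OF C1] by (simp add: gderiv_def)
    qed
    then show "((\<lambda>t. Y (x + t *\<^sub>R ?e)) has_field_derivative gradient Y (x + t *\<^sub>R ?e) $ i)
        (at t within {0..p})"
      by (simp add: has_field_derivative_def inner_axis' mult_commute_abs)
  next
    fix t assume "t \<in> {0..p}"
    show "(\<lambda>x. Y (x + t *\<^sub>R ?e)) integrable_on cbox a b"
      by (intro integrable_continuous continuous_on_compose2[OF contY] continuous_intros) auto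
  next
    show "continuous_on ({0..p} \<times> cbox a b) (\<lambda>(t, x). gradient Y (x + t *\<^sub>R ?e) $ i)"
      unfolding split_beta
      by (intro continuous_intros continuous_on_compose2[OF contG]) auto
  qed (use p in auto)
  moreover have "(?J has_field_derivative 0) (at 0 within {0..p})"
    by (rule has_field_derivative_transform_within
        [where f = "\<lambda>t. integral (cbox a b) Y" and d = 1])
       (use p J in auto)
  moreover have nb: "at 0 within {0..p} \<noteq> bot"
    using p at_within_Icc_at_right[of 0 p] by simp
  ultimately have "integral (cbox a b) (\<lambda>x. gradient Y (x + 0 *\<^sub>R ?e) $ i) = 0"
    using vector_derivative_unique_within[OF nb]
    unfolding has_real_derivative_iff_has_vector_derivative by blast
  then show ?thesis by simp
qed

lemma integral_eq_integral_UNIV: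
  fixes f :: "'a::euclidean_space \<Rightarrow> real"
  assumes "\<And>x. x \<notin> S \<Longrightarrow> f x = 0"
  shows "integral S f = integral UNIV f"
proof -
  have "(\<lambda>x. if x \<in> S then f x else 0) = f"
    using assms by auto
  then show ?thesis
    using integral_restrict_UNIV[of S f] by simp
qed

lemma mem_cbox_cart_split:
  fixes x :: "real ^ 'n"
  shows "x \<in> cbox c d \<longleftrightarrow> (c $ i \<le> x $ i \<and> x $ i \<le> d $ i) \<and>
    (\<forall>j. j \<noteq> i \<longrightarrow> c $ j \<le> x $ j \<and> x $ j \<le> d $ j)"
proof -
  have "(\<forall>j. P j) \<longleftrightarrow> P i \<and> (\<forall>j. j \<noteq> i \<longrightarrow> P j)" for P :: "'n \<Rightarrow> bool"
    by metis
  from this[of "\<lambda>j. c $ j \<le> x $ j \<and> x $ j \<le> d $ j"] show ?thesis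
    unfolding mem_box_cart .
qed

text \<open>The box is large enough to contain \<open>K\<close> even after a unit shift in any coordinate direction.\<close>

lemma bounded_subset_cbox_margin:
  fixes K :: "(real ^ 'n) set"
  assumes "bounded K"
  obtains a b where
    "\<And>t i. 0 \<le> t \<Longrightarrow> t \<le> 1 \<Longrightarrow> K \<subseteq> cbox (a + t *\<^sub>R axis i 1) (b + t *\<^sub>R axis i (1::real))"
proof -
  obtain R where R: "\<And>x. x \<in> K \<Longrightarrow> norm x \<le> R"
    using assms bounded_iff by blast
  have *: "- (R + 2) + 1 \<le> x $ j \<and> x $ j \<le> R + 1" if "x \<in> K" for x j
    using R[OF that] component_le_norm_cart[of x j] by linarith
  show thesis
  proof (rule that[of "\<chi> j. - (R + 2)" "\<chi> j. R + 2"])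
    fix t :: real and i :: 'n assume t: "0 \<le> t" "t \<le> 1"
    show "K \<subseteq> cbox ((\<chi> j. - (R + 2)) + t *\<^sub>R axis i 1) ((\<chi> j. R + 2) + t *\<^sub>R axis i 1)"
    proof
      fix x assume "x \<in> K"
      note x = *[OF this]
      have "0 \<le> t * axis i 1 $ j" "t * axis i 1 $ j \<le> 1" for j
        using t by (auto simp: axis_def)
      note e = this
      have "((\<chi> j. - (R + 2)) + t *\<^sub>R axis i 1) $ j \<le> x $ j \<and>
          x $ j \<le> ((\<chi> j. R + 2) + t *\<^sub>R axis i 1) $ j" for j
        using x[of j] e[of j] by simp
      then show "x \<in> cbox ((\<chi> j. - (R + 2)) + t *\<^sub>R axis i 1)
          ((\<chi> j. R + 2) + t *\<^sub>R axis i 1)"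
        unfolding mem_box_cart by (intro allI)
    qed
  qed
qed

lemma integral_partial_compact_support:
  fixes Y :: "real ^ 'n \<Rightarrow> real"
  assumes C1: "C1_on UNIV Y" and K: "compact K" "\<And>x. x \<notin> K \<Longrightarrow> Y x = 0"
  shows "integrable lebesgue (\<lambda>x. gradient Y x $ i)" (is ?A)
    and "(LINT x|lebesgue. gradient Y x $ i) = 0" (is ?B)
proof -
  obtain a b where ab: "\<And>t i. 0 \<le> t \<Longrightarrow> t \<le> 1 \<Longrightarrow>
      K \<subseteq> cbox (a + t *\<^sub>R axis i 1) (b + t *\<^sub>R axis i (1::real))"
    using bounded_subset_cbox_margin[OF compact_imp_bounded[OF K(1)]] by blast
  then have ab0: "K \<subseteq> cbox a b"
    using ab[of 0] by simp
  have I: "integral (cbox a b) (\<lambda>x. gradient Y x $ i) = 0"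
  proof (rule integral_partial_eq_0_if_translation_invariant[where p = 1, OF C1])
    fix t :: real assume "0 \<le> t" "t \<le> 1"
    then have "integral (cbox (a + t *\<^sub>R axis i 1) (b + t *\<^sub>R axis i 1)) Y = integral UNIV Y"
      using ab K(2) by (intro integral_eq_integral_UNIV) blast
    also have "\<dots> = integral (cbox a b) Y"
      using ab0 K(2) by (intro integral_eq_integral_UNIV[symmetric]) blast
    finally show "integral (cbox (a + t *\<^sub>R axis i 1) (b + t *\<^sub>R axis i 1)) Y
        = integral (cbox a b) Y" .
  qed simp
  have "gradient Y x = 0" if "x \<notin> cbox a b" for x
  proof (rule gradient_zero_open[of "- K"])
    show "open (- K)" "x \<in> - K"
      using K(1) that ab0 by (auto simp: compact_imp_closed open_Compl)
    show "Y y = 0" if "y \<in> - K" for y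
      using K(2) that by simp
  qed
  then have z: "indicator (cbox a b) x *\<^sub>R gradient Y x $ i = gradient Y x $ i" for x
    by (auto simp: indicator_def)
  have ai: "(\<lambda>x. gradient Y x $ i) absolutely_integrable_on cbox a b"
    by (intro absolutely_integrable_continuous continuous_intros
        continuous_on_subset[OF C1_on_continuous_gradient[OF C1]]) auto
  then show ?A
    unfolding set_integrable_def z .
  show ?B
    using set_lebesgue_integral_eq_integral(2)[OF ai] I unfolding set_lebesgue_integral_def z
    by (simp only:)
qed

text \<open>A shift by \<open>t e\<^sub>i\<close> removes a slab at the lower face of the cell and adds a slab at the upper
face; the two slabs differ by one period.\<close>

lemma integral_partial_periodic:
  fixes Y :: "real ^ 'n \<Rightarrow> real"
  assumes C1: "C1_on UNIV Y" and ab: "\<And>j. a $ j < b $ j" and per: "cell_periodic (b - a) Y"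
  shows "integral (cbox a b) (\<lambda>x. gradient Y x $ i) = 0"
proof (rule integral_partial_eq_0_if_translation_invariant[OF C1, where p = "b $ i - a $ i"])
  fix t assume t: "0 \<le> t" "t \<le> b $ i - a $ i"
  let ?e = "axis i 1 :: real ^ 'n"
  let ?a = "a + t *\<^sub>R ?e" and ?b = "b + t *\<^sub>R ?e"
  define u where "u = (\<chi> j. if j = i then a $ i + t else b $ j)"
  let ?P = "axis i (b $ i - a $ i) :: real ^ 'n"
  have int: "Y integrable_on cbox c d" for c d
    by (intro integrable_continuous continuous_on_subset[OF C1_on_continuous[OF C1]]) auto
  have e: "?e \<in> Basis"
    by (auto simp: axis_in_Basis_iff)
  have xe: "x \<bullet> ?e = x $ i" for x
    by (simp add: inner_axis)
  \<comment> \<open>The common part of the cell and its shift.\<close>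
  have 1: "cbox ?a ?b \<inter> {x. x $ i \<le> b $ i} = cbox a b \<inter> {x. x $ i \<ge> a $ i + t}"
    using t by (auto simp: mem_cbox_cart_split[where i = i] axis_def)
  \<comment> \<open>The slab that is left behind, and the slab that is gained.\<close>
  have 2: "cbox a b \<inter> {x. x $ i \<le> a $ i + t} = cbox a u"
    using t by (auto simp: mem_cbox_cart_split[where i = i] u_def)
  have 3: "cbox ?a ?b \<inter> {x. x $ i \<ge> b $ i} = cbox (a + ?P) (u + ?P)"
    using t by (auto simp: mem_cbox_cart_split[where i = i] u_def axis_def)
  have "integral (cbox (a + ?P) (u + ?P)) Y = integral (cbox a u) (\<lambda>x. Y (x + ?P))"
    using integral_shift_cbox[of "a + ?P" ?P "u + ?P" Y] by simp
  also have "\<dots> = integral (cbox a u) Y"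
    using per by (simp add: cell_periodic_def)
  finally have 4: "integral (cbox (a + ?P) (u + ?P)) Y = integral (cbox a u) Y" .
  have "integral (cbox ?a ?b) Y
      = integral (cbox ?a ?b \<inter> {x. x $ i \<le> b $ i}) Y + integral (cbox ?a ?b \<inter> {x. x $ i \<ge> b $ i}) Y"
    using integral_split[OF int e, of ?a ?b "b $ i"] by (simp add: xe)
  also have "\<dots> = integral (cbox a b \<inter> {x. x $ i \<le> a $ i + t}) Y
      + integral (cbox a b \<inter> {x. x $ i \<ge> a $ i + t}) Y"
    unfolding 1 2 3 4 by simp
  also have "\<dots> = integral (cbox a b) Y"
    using integral_split[OF int e, of a b "a $ i + t"] by (simp add: xe)
  finally show "integral (cbox ?a ?b) Y = integral (cbox a b) Y" .
qed (use ab in auto)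

section \<open>Continuously differentiable cutoffs\<close>

text \<open>The simplest continuously differentiable function that vanishes exactly on a half line; all
cutoffs are composed from it.\<close>

definition pos_sq :: "real \<Rightarrow> real" where
  "pos_sq t = (max 0 t)\<^sup>2"

lemma DERIV_pos_sq: "DERIV pos_sq t :> 2 * max 0 t"
proof -
  consider "t > 0" | "t < 0" | "t = 0" by linarith
  then show ?thesis
  proof cases
    case 1
    have "DERIV (\<lambda>t. t\<^sup>2) t :> 2 * t"
      by (auto intro!: derivative_eq_intros)
    then have "DERIV pos_sq t :> 2 * t"
      by (rule has_field_derivative_transform_within_open[where S = "{0<..}"])
         (use 1 in \<open>auto simp: pos_sq_def\<close>)
    with 1 show ?thesis by simp
  next
    case 2
    have "DERIV (\<lambda>t. 0::real) t :> 0"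
      by simp
    then have "DERIV pos_sq t :> 0"
      by (rule has_field_derivative_transform_within_open[where S = "{..<0}"])
         (use 2 in \<open>auto simp: pos_sq_def\<close>)
    with 2 show ?thesis by simp
  next
    case 3
    have "norm (pos_sq h / h) \<le> \<bar>h\<bar>" for h
      by (auto simp: pos_sq_def power2_eq_square max_def)
    then have "\<forall>\<^sub>F h in at 0. norm (pos_sq h / h) \<le> \<bar>h\<bar>"
      by (intro always_eventually allI)
    moreover have "((\<lambda>h::real. \<bar>h\<bar>) \<longlongrightarrow> 0) (at 0)"
      by (intro tendsto_rabs_zero tendsto_ident_at)
    ultimately have "((\<lambda>h. pos_sq h / h) \<longlongrightarrow> 0) (at 0)"
      by (rule Lim_null_comparison)
    with 3 show ?thesis
      by (simp add: DERIV_def) (simp add: pos_sq_def)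
  qed
qed

lemma pos_sq_bounds:
  "0 \<le> pos_sq t" "t \<le> 1 \<Longrightarrow> pos_sq t \<le> 1" "1 \<le> t \<Longrightarrow> 1 \<le> pos_sq t" "t \<le> 0 \<Longrightarrow> pos_sq t = 0"
  by (auto simp: pos_sq_def max_def power_le_one one_le_power)

text \<open>Both pieces join with continuous derivative: the value is \<open>0\<close> for \<open>t \<le> 0\<close>, where the inner square
vanishes, and \<open>1\<close> for \<open>t \<ge> 1\<close>, where the outer one does.\<close>

definition smooth_step :: "real \<Rightarrow> real" where
  "smooth_step t = 1 - pos_sq (1 - pos_sq t)"

definition smooth_step' :: "real \<Rightarrow> real" where
  "smooth_step' t = 4 * max 0 (1 - pos_sq t) * max 0 t"

lemma DERIV_smooth_step: "DERIV smooth_step t :> smooth_step' t"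
  unfolding smooth_step_def[abs_def]
  by (auto simp: smooth_step'_def intro!: derivative_eq_intros DERIV_chain2[OF DERIV_pos_sq]
      DERIV_pos_sq)

lemma continuous_on_smooth_step': "continuous_on S smooth_step'"
  unfolding smooth_step'_def pos_sq_def by (intro continuous_intros)

lemma smooth_step_bounds: "0 \<le> smooth_step t" "smooth_step t \<le> 1"
  using pos_sq_bounds(1)[of t] pos_sq_bounds(1,2)[of "1 - pos_sq t"]
  by (auto simp: smooth_step_def)

lemma smooth_step_eq: "t \<le> 0 \<Longrightarrow> smooth_step t = 0" "1 \<le> t \<Longrightarrow> smooth_step t = 1"
  using pos_sq_bounds(3)[of t]
  by (auto simp: smooth_step_def pos_sq_bounds(4)) (simp add: pos_sq_def)

lemma smooth_step'_bounds: "0 \<le> smooth_step' t" "smooth_step' t \<le> 4"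
proof -
  show "0 \<le> smooth_step' t"
    by (auto simp: smooth_step'_def)
  have "max 0 (1 - pos_sq t) * max 0 t \<le> 1 * 1" if "t \<le> 1"
    using that pos_sq_bounds(1)[of t] by (intro mult_mono) auto
  moreover have "max 0 (1 - pos_sq t) * max 0 t = 0" if "t > 1"
    using that pos_sq_bounds(3)[of t] by auto
  ultimately show "smooth_step' t \<le> 4"
    by (cases "t \<le> 1") (auto simp: smooth_step'_def)
qed

lemma smooth_step'_eq_0: "t \<le> 0 \<or> 1 \<le> t \<Longrightarrow> smooth_step' t = 0"
  using pos_sq_bounds(3)[of t] by (auto simp: smooth_step'_def)

text \<open>The argument of the step is \<open>0\<close> at distance \<open>r\<close> and \<open>1\<close> at distance \<open>2r\<close>, since
\<open>((2r)\<^sup>2/r\<^sup>2 - 1)/3 = 1\<close>. The squared distance keeps the function differentiable at the centre.\<close>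

definition bump :: "real ^ 'n \<Rightarrow> real \<Rightarrow> real ^ 'n \<Rightarrow> real" where
  "bump c r x = 1 - smooth_step (((x - c) \<bullet> (x - c) / r\<^sup>2 - 1) / 3)"

lemma GDERIV_bump:
  assumes "r > 0"
  shows "GDERIV (bump c r) x :>
    (- (smooth_step' (((x - c) \<bullet> (x - c) / r\<^sup>2 - 1) / 3) * (2 / (3 * r\<^sup>2)))) *\<^sub>R (x - c)"
proof -
  let ?g = "\<lambda>t. 1 - smooth_step ((t / r\<^sup>2 - 1) / 3)"
  have "GDERIV (\<lambda>x. (x - c) \<bullet> (x - c)) x :> 2 *\<^sub>R (x - c)"
    unfolding gderiv_def
    by (auto intro!: derivative_eq_intros simp: inner_commute)
  moreover have "DERIV ?g t :> - (smooth_step' ((t / r\<^sup>2 - 1) / 3) * (1 / r\<^sup>2 / 3))" for t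
  proof -
    have "DERIV (\<lambda>t. (t / r\<^sup>2 - 1) / 3) t :> (1 / r\<^sup>2 - 0) / 3"
      by (intro DERIV_cdivide DERIV_diff DERIV_ident DERIV_const)
    from DERIV_diff[OF DERIV_const[of 1] DERIV_chain2[OF DERIV_smooth_step this]]
    show ?thesis
      by simp
  qed
  ultimately have "GDERIV (\<lambda>x. ?g ((x - c) \<bullet> (x - c))) x :>
      (- (smooth_step' (((x - c) \<bullet> (x - c) / r\<^sup>2 - 1) / 3) * (1 / r\<^sup>2 / 3))) *\<^sub>R 2 *\<^sub>R (x - c)"
    by (rule GDERIV_DERIV_compose[where g = ?g])
  then show ?thesis
    unfolding bump_def[abs_def] by (simp add: mult_ac)
qed

lemma C1_on_bump:
  assumes "r > 0"
  shows "C1_on S (bump c r)"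
  by (rule C1_onI[OF _ GDERIV_bump[OF assms]])
     (intro continuous_intros continuous_on_compose2[OF continuous_on_smooth_step'[of UNIV]],
      use assms in auto)

lemma bump_bounds: "0 \<le> bump c r x" "bump c r x \<le> 1"
  using smooth_step_bounds by (auto simp: bump_def)

lemma bump_eq_1:
  assumes "r > 0" "dist c x \<le> r"
  shows "bump c r x = 1"
proof -
  have "(x - c) \<bullet> (x - c) \<le> r\<^sup>2"
    using assms power_mono[of "norm (x - c)" r 2] by (simp add: dot_square_norm dist_norm norm_minus_commute)
  then show ?thesis
    using assms by (simp add: bump_def smooth_step_eq)
qed

lemma bump_arg_ge_1:
  assumes "r > 0" "2 * r \<le> dist c x"
  shows "1 \<le> ((x - c) \<bullet> (x - c) / r\<^sup>2 - 1) / 3"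
proof -
  have "4 * r\<^sup>2 \<le> (x - c) \<bullet> (x - c)"
    using assms power_mono[of "2 * r" "norm (x - c)" 2]
    by (simp add: dot_square_norm dist_norm norm_minus_commute power_mult_distrib)
  then show ?thesis
    using assms by (simp add: field_simps)
qed

lemma bump_eq_0:
  assumes "r > 0" "2 * r \<le> dist c x"
  shows "bump c r x = 0"
  using bump_arg_ge_1[OF assms] by (simp add: bump_def smooth_step_eq)

lemma gradient_bump_eq_0:
  assumes "r > 0" "2 * r \<le> dist c x"
  shows "gradient (bump c r) x = 0"
  using gradient_eq[OF GDERIV_bump[OF assms(1), of c x]] bump_arg_ge_1[OF assms]
  by (simp add: smooth_step'_eq_0)

lemma norm_gradient_bump_le:
  assumes "r > 0"
  shows "norm (gradient (bump c r) x) \<le> 6 / r"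
proof (cases "2 * r \<le> dist c x")
  case True
  then show ?thesis
    using gradient_bump_eq_0[OF assms True] assms by simp
next
  case False
  let ?s = "smooth_step' (((x - c) \<bullet> (x - c) / r\<^sup>2 - 1) / 3)"
  have "norm (gradient (bump c r) x) = ?s * (2 / (3 * r\<^sup>2)) * norm (x - c)"
    using smooth_step'_bounds(1) by (simp add: gradient_eq[OF GDERIV_bump[OF assms]] abs_mult)
  also have "\<dots> \<le> 4 * (2 / (3 * r\<^sup>2)) * (2 * r)"
    using False smooth_step'_bounds assms
    by (intro mult_mono) (auto simp: dist_norm norm_minus_commute)
  also have "\<dots> \<le> 6 / r"
    using assms by (simp add: field_simps power2_eq_square)
  finally show ?thesis .
qed

section \<open>Integrability of products\<close>

lemma integrable_continuous_compact_support:
  fixes f :: "real ^ 'n \<Rightarrow> real"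
  assumes "compact K" "continuous_on K f" "\<And>x. x \<notin> K \<Longrightarrow> f x = 0"
  shows "integrable lebesgue f"
proof -
  have "integrable lborel (\<lambda>x. indicator K x *\<^sub>R f x)"
    using assms by (intro borel_integrable_compact)
  moreover have "(\<lambda>x. indicator K x *\<^sub>R f x) = f"
  proof
    show "indicator K x *\<^sub>R f x = f x" for x
      using assms(3)[of x] by (cases "x \<in> K") auto
  qed
  ultimately show ?thesis
    by (simp add: integrable_completion)
qed

lemma set_borel_measurable_continuous_open:
  fixes f :: "real ^ 'n \<Rightarrow> real"
  assumes "open S" "continuous_on S f"
  shows "set_borel_measurable lebesgue S f"
proof -
  have "f \<in> borel_measurable (lebesgue_on S)"
    using assms by (intro continuous_imp_measurable_on_sets_lebesgue) auto
  then show ?thesis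
    using assms unfolding set_borel_measurable_def
    by (subst (asm) borel_measurable_restrict_space_iff) auto
qed

lemma set_borel_measurable_times:
  fixes f g :: "'a \<Rightarrow> real"
  assumes "set_borel_measurable M S f" "set_borel_measurable M S g"
  shows "set_borel_measurable M S (\<lambda>x. f x * g x)"
proof -
  have "(\<lambda>x. indicator S x *\<^sub>R (f x * g x)) = (\<lambda>x. (indicator S x *\<^sub>R f x) * (indicator S x *\<^sub>R g x))"
    by (auto simp: indicator_def)
  then show ?thesis
    using borel_measurable_times[OF assms[unfolded set_borel_measurable_def]]
    unfolding set_borel_measurable_def by (simp only:)
qed

lemma set_integrable_bounded_continuous:
  fixes f :: "real ^ 'n \<Rightarrow> real"
  assumes "open S" "bounded S" "continuous_on S f" "\<And>x. x \<in> S \<Longrightarrow> \<bar>f x\<bar> \<le> C"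
  shows "set_integrable lebesgue S f"
proof (rule set_integrable_bound[where f = "\<lambda>x. C"])
  have "S \<in> lmeasurable"
    using assms by (simp add: lmeasurable_open)
  then show "set_integrable lebesgue S (\<lambda>x. C)"
    unfolding set_integrable_def by (simp add: lmeasurable_iff_integrable)
  show "AE x in lebesgue. x \<in> S \<longrightarrow> norm (f x) \<le> norm C"
    using assms(4) by force
qed (use assms set_borel_measurable_continuous_open in auto)

lemma set_integrable_bounded_mult:
  fixes f g :: "real ^ 'n \<Rightarrow> real"
  assumes "set_borel_measurable lebesgue S g" "\<And>x. x \<in> S \<Longrightarrow> \<bar>g x\<bar> \<le> C"
    and "set_integrable lebesgue S f"
  shows "set_integrable lebesgue S (\<lambda>x. g x * f x)"
proof (rule set_integrable_bound[where f = "\<lambda>x. C * f x"])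
  show "set_integrable lebesgue S (\<lambda>x. C * f x)"
    using assms(3) by simp
  have "set_borel_measurable lebesgue S f"
    using assms(3) by (auto simp: set_integrable_def set_borel_measurable_def)
  with assms(1) show "set_borel_measurable lebesgue S (\<lambda>x. g x * f x)"
    by (rule set_borel_measurable_times)
  have "\<bar>g x\<bar> * \<bar>f x\<bar> \<le> \<bar>C\<bar> * \<bar>f x\<bar>" if "x \<in> S" for x
    using assms(2)[OF that] by (intro mult_right_mono) auto
  then show "AE x in lebesgue. x \<in> S \<longrightarrow> norm (g x * f x) \<le> norm (C * f x)"
    by (auto simp: abs_mult)
qed

section \<open>Layers along a regular boundary\<close>

definition divergence :: "(real ^ 'n \<Rightarrow> real ^ 'n) \<Rightarrow> real ^ 'n \<Rightarrow> real" where
  "divergence X x = (\<Sum>i\<in>UNIV. gradient (\<lambda>y. X y $ i) x $ i)"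

lemma divergence_scaleR:
  assumes "C1_on S \<eta>" "\<And>i. C1_on S (\<lambda>y. X y $ i)" "x \<in> S"
  shows "divergence (\<lambda>y. \<eta> y *\<^sub>R X y) x = \<eta> x * divergence X x + gradient \<eta> x \<bullet> X x"
proof -
  have "gradient (\<lambda>y. \<eta> y * X y $ i) x $ i = \<eta> x * gradient (\<lambda>y. X y $ i) x $ i + gradient \<eta> x $ i * X x $ i"
    for i
    by (simp add: gradient_mult[OF assms(1) assms(2)[of i] assms(3)] mult.commute)
  then show ?thesis
    by (simp add: divergence_def inner_vec_def sum.distrib sum_distrib_left)
qed

text \<open>A product with a cutoff is integrated over the domain, while the integration by parts is over
the whole space; this lemma passes from the one to the other.\<close>

lemma set_lebesgue_integral_eq_0_outside:
  fixes f :: "'a \<Rightarrow> real"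
  assumes "\<And>x. x \<in> S \<Longrightarrow> g x = f x" "\<And>x. x \<notin> S \<Longrightarrow> g x = 0"
  shows "set_lebesgue_integral M S f = integral\<^sup>L M g"
proof -
  have "indicator S x *\<^sub>R f x = g x" for x
    using assms(1,2)[of x] by (cases "x \<in> S") auto
  then show ?thesis
    by (simp only: set_lebesgue_integral_def)
qed

lemma abs_set_integral_le_integral:
  fixes f g :: "'a::euclidean_space \<Rightarrow> real"
  assumes "set_integrable M S f" "integrable M g"
    and "\<And>x. x \<in> S \<Longrightarrow> \<bar>f x\<bar> \<le> g x" "\<And>x. 0 \<le> g x"
  shows "\<bar>LINT x:S|M. f x\<bar> \<le> integral\<^sup>L M g"
proof -
  have "norm (LINT x|M. indicator S x *\<^sub>R f x) \<le> integral\<^sup>L M g"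
  proof (rule Bochner_Integration.integral_norm_bound_integral)
    show "norm (indicator S x *\<^sub>R f x) \<le> g x" for x
      using assms(3,4)[of x] by (cases "x \<in> S") auto
  qed (use assms in \<open>auto simp: set_integrable_def\<close>)
  then show ?thesis
    by (simp add: set_lebesgue_integral_def)
qed

text \<open>For \<open>k > 0\<close>, applied to \<open>t = \<rho> y\<close>, where \<open>\<rho> < 0\<close> defines the domain, this step is \<open>0\<close> for
\<open>\<rho> y \<ge> - 1/k\<close> and \<open>1\<close> for \<open>\<rho> y \<le> - 2/k\<close>.\<close>

lemma DERIV_boundary_step:
  "DERIV (\<lambda>t. smooth_step (- (k * t) - 1)) t :> - k * smooth_step' (- (k * t) - 1)"
proof -
  have "DERIV (\<lambda>t. - (k * t) - 1) t :> - k"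
    by (auto intro!: derivative_eq_intros)
  from DERIV_chain2[OF DERIV_smooth_step this] show ?thesis
    by (simp add: mult.commute)
qed

lemma continuous_on_boundary_step':
  "continuous_on S (\<lambda>t. - k * smooth_step' (- (k * t) - 1))"
  by (intro continuous_intros continuous_on_compose2[OF continuous_on_smooth_step'[of UNIV]]) auto

text \<open>The boundary layer has thickness \<open>O(1/k)\<close>, so that the function \<open>k smooth_step'\<close>, of size \<open>k\<close> on
it, has bounded integral. Instead of estimating the volume of the layer, integrate by parts: up
to sign and the factor \<open>\<partial>\<^sub>i\<rho>\<close>, which stays away from zero, the integrand is \<open>\<psi>\<close> times a partial
derivative of the step, and moving the derivative to the bump \<open>\<psi>\<close> leaves \<open>\<integral> |\<partial>\<^sub>i\<psi>|\<close>, a bound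
that does not depend on \<open>k\<close>.\<close>

lemma boundary_layer_mass_bounded:
  fixes \<rho> :: "real ^ 'n \<Rightarrow> real"
  assumes \<rho>: "C1_on V \<rho>" and V: "open V" "cball z (2 * r) \<subseteq> V" and r: "r > 0"
    and c: "c > 0" "\<bar>\<sigma>\<bar> = 1" "\<And>y. y \<in> cball z (2 * r) \<Longrightarrow> c \<le> \<sigma> * gradient \<rho> y $ i"
  obtains M where "M \<ge> 0"
    and "\<And>k. k > 0 \<Longrightarrow> integrable lebesgue (\<lambda>y. bump z r y * (k * smooth_step' (- (k * \<rho> y) - 1)))"
    and "\<And>k. k > 0 \<Longrightarrow> (LINT y|lebesgue. bump z r y * (k * smooth_step' (- (k * \<rho> y) - 1))) \<le> M"
proof -
  let ?\<psi> = "bump z r" and ?B = "cball z (2 * r)"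
  have zero: "?\<psi> y = 0" "gradient ?\<psi> y = 0" if "y \<notin> ?B" for y
    using that r bump_eq_0[of r z y] gradient_bump_eq_0[of r z y] by auto
  have \<psi>: "C1_on S ?\<psi>" for S
    using C1_on_bump[OF r] .
  have int_\<psi>: "integrable lebesgue (\<lambda>y. \<bar>gradient ?\<psi> y $ i\<bar>)"
    by (rule integrable_continuous_compact_support[of ?B])
       (auto intro!: continuous_intros C1_on_continuous_gradient \<psi> simp: zero)
  define M where "M = (LINT y|lebesgue. \<bar>gradient ?\<psi> y $ i\<bar>) / c"
  have main: "integrable lebesgue (\<lambda>y. ?\<psi> y * (k * smooth_step' (- (k * \<rho> y) - 1))) \<and>
      (LINT y|lebesgue. ?\<psi> y * (k * smooth_step' (- (k * \<rho> y) - 1))) \<le> M" if k: "k > 0" for k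
  proof -
    let ?s = "\<lambda>y. smooth_step (- (k * \<rho> y) - 1)" and ?s' = "\<lambda>y. k * smooth_step' (- (k * \<rho> y) - 1)"
    have C1s: "C1_on V ?s"
      using C1_on_compose[OF \<rho> DERIV_boundary_step continuous_on_boundary_step'] .
    have C1Y: "C1_on UNIV (\<lambda>y. ?\<psi> y * ?s y)"
      by (rule C1_on_extend_zero[OF V(1) closed_cball V(2) C1_on_mult[OF \<psi> C1s]])
         (simp add: zero)
    have sub: "continuous_on ?B \<rho>"
      using continuous_on_subset[OF C1_on_continuous[OF \<rho>] V(2)] .
    \<comment> \<open>The product rule for \<open>?\<psi> * ?s\<close>, valid everywhere since all terms vanish off \<open>?B\<close>.\<close>
    have id: "?\<psi> y * ?s' y * gradient \<rho> y $ i
        = ?s y * gradient ?\<psi> y $ i - gradient (\<lambda>y. ?\<psi> y * ?s y) y $ i" for y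
    proof (cases "y \<in> ?B")
      case True
      then have y: "y \<in> V" using V(2) by blast
      have "gradient ?s y = (- k * smooth_step' (- (k * \<rho> y) - 1)) *\<^sub>R gradient \<rho> y"
        by (rule gradient_compose[OF \<rho> DERIV_boundary_step y])
      then show ?thesis
        by (simp add: gradient_mult[OF \<psi> C1s y])
    next
      case False
      moreover have "gradient (\<lambda>y. ?\<psi> y * ?s y) y = 0"
        using False by (intro gradient_zero_open[of "- ?B"]) (auto simp: zero)
      ultimately show ?thesis
        by (simp add: zero)
    qed
    have int: "integrable lebesgue (\<lambda>y. ?\<psi> y * ?s' y)"
      by (rule integrable_continuous_compact_support[of ?B])
         (auto intro!: continuous_intros C1_on_continuous[OF \<psi>] sub
            continuous_on_compose2[OF continuous_on_smooth_step'[of UNIV]] simp: zero)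
    have cs: "continuous_on UNIV smooth_step"
      using DERIV_smooth_step DERIV_isCont continuous_at_imp_continuous_on by blast
    have int_s: "integrable lebesgue (\<lambda>y. \<sigma> * (?s y * gradient ?\<psi> y $ i))"
      by (rule integrable_continuous_compact_support[of ?B])
         (auto intro!: continuous_intros C1_on_continuous_gradient[OF \<psi>] sub
            continuous_on_compose2[OF cs] simp: zero)
    have supp: "(\<lambda>y. ?\<psi> y * ?s y) y = 0" if "y \<notin> ?B" for y
      using zero[OF that] by simp
    note Y = integral_partial_compact_support[OF C1Y compact_cball supp, where i = i]
    have "c * (LINT y|lebesgue. ?\<psi> y * ?s' y) = (LINT y|lebesgue. c * (?\<psi> y * ?s' y))"
      by simp
    also have "\<dots> \<le> (LINT y|lebesgue. \<sigma> * (?s y * gradient ?\<psi> y $ i)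
        - \<sigma> * gradient (\<lambda>y. ?\<psi> y * ?s y) y $ i)"
    proof (rule integral_mono)
      fix y
      have "c * (?\<psi> y * ?s' y) \<le> \<sigma> * gradient \<rho> y $ i * (?\<psi> y * ?s' y)"
      proof (cases "y \<in> ?B")
        case True
        then show ?thesis
          using c(3)[OF True] k bump_bounds(1) smooth_step'_bounds(1)
          by (intro mult_right_mono mult_nonneg_nonneg) auto
      qed (simp add: zero)
      also have "\<dots> = \<sigma> * (?\<psi> y * ?s' y * gradient \<rho> y $ i)"
        by simp
      finally show "c * (?\<psi> y * ?s' y) \<le> \<sigma> * (?s y * gradient ?\<psi> y $ i)
        - \<sigma> * gradient (\<lambda>y. ?\<psi> y * ?s y) y $ i"
        unfolding id by (simp add: right_diff_distrib)
    qed (use int int_s Y in auto)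
    also have "\<dots> = (LINT y|lebesgue. \<sigma> * (?s y * gradient ?\<psi> y $ i))"
      using int_s Y by simp
    also have "\<dots> \<le> (LINT y|lebesgue. \<bar>gradient ?\<psi> y $ i\<bar>)"
    proof (rule integral_mono[OF int_s int_\<psi>])
      fix y
      have "\<bar>\<sigma> * (?s y * gradient ?\<psi> y $ i)\<bar> \<le> 1 * (1 * \<bar>gradient ?\<psi> y $ i\<bar>)"
        unfolding abs_mult using c(2) smooth_step_bounds by (intro mult_mono) auto
      then show "\<sigma> * (?s y * gradient ?\<psi> y $ i) \<le> \<bar>gradient ?\<psi> y $ i\<bar>"
        by simp
    qed
    finally show ?thesis
      using c(1) int by (simp add: M_def field_simps)
  qed
  show thesis
    by (rule that[of M]) (use main c(1) in \<open>auto simp: M_def\<close>)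
qed

section \<open>Tangential fields and their flux\<close>

text \<open>\<open>X\<close> is differentiable only in the open domain. On the boundary it takes its continuous
limits, and it is tangential wherever there is a normal.\<close>

locale tangential_field =
  fixes \<Omega> :: "(real ^ 'n) set" and X :: "real ^ 'n \<Rightarrow> real ^ 'n"
  assumes open_domain: "open \<Omega>" and bounded_domain: "bounded \<Omega>"
    and C1_components: "\<And>i. C1_on \<Omega> (\<lambda>x. X x $ i)"
    and continuous_field: "continuous_on (closure \<Omega>) X"
    and tangential: "\<And>x \<nu>. outer_normal \<Omega> x \<nu> \<Longrightarrow> X x \<bullet> \<nu> = 0"
    and integrable_divergence: "set_integrable lebesgue \<Omega> (divergence X)"
begin

lemma compact_closure_domain: "compact (closure \<Omega>)"
  using bounded_domain by (simp add: compact_closure)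

lemma bounded_field: obtains C where "C \<ge> 0" "\<And>x. x \<in> closure \<Omega> \<Longrightarrow> norm (X x) \<le> C"
proof -
  have "bounded (X ` closure \<Omega>)"
    by (intro compact_imp_bounded compact_continuous_image continuous_field compact_closure_domain)
  then obtain C where C: "\<And>x. x \<in> closure \<Omega> \<Longrightarrow> norm (X x) \<le> C"
    by (auto simp: bounded_iff)
  show thesis
    by (rule that[of "max C 0"]) (use C in \<open>auto simp: le_max_iff_disj\<close>)
qed

lemma continuous_on_inner_field:
  assumes "continuous_on S g" "S \<subseteq> closure \<Omega>"
  shows "continuous_on S (\<lambda>x. g x \<bullet> X x)"
  using assms continuous_on_subset[OF continuous_field] by (intro continuous_intros)

lemma bounded_on_domain:
  fixes g :: "real ^ 'n \<Rightarrow> real"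
  assumes "continuous_on (closure \<Omega>) g"
  obtains C where "C \<ge> 0" "\<And>x. x \<in> \<Omega> \<Longrightarrow> \<bar>g x\<bar> \<le> C"
proof -
  have "bounded (g ` closure \<Omega>)"
    by (intro compact_imp_bounded compact_continuous_image assms compact_closure_domain)
  then obtain C where C: "\<And>x. x \<in> closure \<Omega> \<Longrightarrow> \<bar>g x\<bar> \<le> C"
    by (auto simp: bounded_iff)
  show thesis
    by (rule that[of "max C 0"])
       (use C closure_subset[of \<Omega>] in \<open>auto simp: le_max_iff_disj\<close>)
qed

lemma integrable_mult_divergence:
  assumes "C1_on UNIV \<eta>"
  shows "set_integrable lebesgue \<Omega> (\<lambda>x. \<eta> x * divergence X x)"
proof -
  have c: "continuous_on S \<eta>" for S
    using continuous_on_subset[OF C1_on_continuous[OF assms]] by auto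
  obtain C where "\<And>x. x \<in> \<Omega> \<Longrightarrow> \<bar>\<eta> x\<bar> \<le> C"
    using bounded_on_domain[OF c] by blast
  then show ?thesis
    using set_integrable_bounded_mult[OF set_borel_measurable_continuous_open[OF open_domain c]
        _ integrable_divergence] by blast
qed

lemma integrable_gradient_inner:
  assumes "C1_on UNIV \<eta>"
  shows "set_integrable lebesgue \<Omega> (\<lambda>x. gradient \<eta> x \<bullet> X x)"
proof -
  have c: "continuous_on (closure \<Omega>) (\<lambda>x. gradient \<eta> x \<bullet> X x)"
    using continuous_on_subset[OF C1_on_continuous_gradient[OF assms]]
    by (intro continuous_on_inner_field) auto
  obtain C where "\<And>x. x \<in> \<Omega> \<Longrightarrow> \<bar>gradient \<eta> x \<bullet> X x\<bar> \<le> C"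
    using bounded_on_domain[OF c] by blast
  then show ?thesis
    using continuous_on_subset[OF c closure_subset]
    by (intro set_integrable_bounded_continuous[OF open_domain bounded_domain])
qed

text \<open>This is the integral of the divergence of \<open>\<eta> X\<close> over the domain, hence formally the flux of
\<open>\<eta> X\<close> through the boundary. The goal is that it vanishes for \<open>\<eta> = 1\<close>.\<close>

definition flux :: "(real ^ 'n \<Rightarrow> real) \<Rightarrow> real" where
  "flux \<eta> = (LINT x:\<Omega>|lebesgue. \<eta> x * divergence X x + gradient \<eta> x \<bullet> X x)"

lemma flux_eq:
  assumes "C1_on UNIV \<eta>"
  shows "flux \<eta> = (LINT x:\<Omega>|lebesgue. \<eta> x * divergence X x)
    + (LINT x:\<Omega>|lebesgue. gradient \<eta> x \<bullet> X x)"
  unfolding flux_def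
  using integrable_mult_divergence[OF assms] integrable_gradient_inner[OF assms] by simp

lemma flux_cong:
  assumes "\<And>x. \<eta> x = \<zeta> x"
  shows "flux \<eta> = flux \<zeta>"
  using ext[of \<eta> \<zeta>, OF assms] by simp

lemma flux_add:
  assumes "C1_on UNIV \<eta>" "C1_on UNIV \<zeta>"
  shows "flux (\<lambda>x. \<eta> x + \<zeta> x) = flux \<eta> + flux \<zeta>"
proof -
  have g: "gradient (\<lambda>x. \<eta> x + \<zeta> x) x = gradient \<eta> x + gradient \<zeta> x" for x
    using assms by (intro gradient_eq GDERIV_add C1_on_GDERIV) auto
  have *: "(\<lambda>x. (\<eta> x + \<zeta> x) * divergence X x + gradient (\<lambda>x. \<eta> x + \<zeta> x) x \<bullet> X x)
    = (\<lambda>x. (\<eta> x * divergence X x + gradient \<eta> x \<bullet> X x)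
         + (\<zeta> x * divergence X x + gradient \<zeta> x \<bullet> X x))"
    unfolding g by (simp add: algebra_simps)
  show ?thesis
    unfolding flux_def *
    by (intro set_integral_add set_integral_add(1) integrable_mult_divergence
        integrable_gradient_inner assms)
qed

lemma flux_compact_support:
  assumes "C1_on UNIV \<eta>" "compact K" "K \<subseteq> \<Omega>" "\<And>x. x \<notin> K \<Longrightarrow> \<eta> x = 0"
  shows "flux \<eta> = 0"
proof -
  let ?Y = "\<lambda>i x. \<eta> x * X x $ i"
  have Y: "C1_on UNIV (?Y i)" for i
    by (rule C1_on_extend_zero[OF open_domain compact_imp_closed[OF assms(2)] assms(3)])
       (use assms(4) C1_on_mult[OF C1_on_subset[OF assms(1)] C1_components] in auto)
  note supp = integral_partial_compact_support[OF Y assms(2)]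
  have "flux \<eta> = (LINT x|lebesgue. (\<Sum>i\<in>UNIV. gradient (?Y i) x $ i))"
    unfolding flux_def
  proof (rule set_lebesgue_integral_eq_0_outside)
    fix x assume "x \<in> \<Omega>"
    from divergence_scaleR[OF C1_on_subset[OF assms(1)] C1_components this]
    show "(\<Sum>i\<in>UNIV. gradient (?Y i) x $ i) = \<eta> x * divergence X x + gradient \<eta> x \<bullet> X x"
      by (simp add: divergence_def)
  next
    fix x assume "x \<notin> \<Omega>"
    then have "gradient (?Y i) x = 0" for i
      using assms by (intro gradient_zero_open[of "- K"]) (auto intro: compact_imp_closed)
    then show "(\<Sum>i\<in>UNIV. gradient (?Y i) x $ i) = 0"
      by simp
  qed
  also have "\<dots> = (\<Sum>i\<in>UNIV. (LINT x|lebesgue. gradient (?Y i) x $ i))"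
    using supp(1) assms(4) by (intro Bochner_Integration.integral_sum) auto
  also have "\<dots> = 0"
    using supp(2) assms(4) by (intro sum.neutral) auto
  finally show ?thesis .
qed

text \<open>The points of \<open>B\<close> in the closed domain where \<open>\<nabla>\<rho> \<bullet> X\<close> is not small form a compact set. It
contains no boundary point, because \<open>\<nabla>\<rho>\<close> is normal there, so \<open>\<rho>\<close> has a negative maximum on it.\<close>

lemma normal_component_small_near_boundary:
  assumes \<rho>: "C1_on V \<rho>" "open V" "\<And>y. y \<in> V \<Longrightarrow> gradient \<rho> y \<noteq> 0"
    and \<Omega>V: "\<Omega> \<inter> V = {y \<in> V. \<rho> y < 0}" and B: "compact B" "B \<subseteq> V" and "e > 0"
  obtains h where "h > 0" "\<And>y. y \<in> B \<Longrightarrow> y \<in> \<Omega> \<Longrightarrow> - h < \<rho> y \<Longrightarrow> \<bar>gradient \<rho> y \<bullet> X y\<bar> < e"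
proof -
  let ?f = "\<lambda>y. \<bar>gradient \<rho> y \<bullet> X y\<bar>"
  define T where "T = {y \<in> B \<inter> closure \<Omega>. e \<le> ?f y}"
  have cB: "compact (B \<inter> closure \<Omega>)"
    using B compact_closure_domain by (simp add: compact_Int)
  have cf: "continuous_on (B \<inter> closure \<Omega>) ?f"
    using continuous_on_subset[OF C1_on_continuous_gradient[OF \<rho>(1)], of "B \<inter> closure \<Omega>"] B(2)
    by (intro continuous_on_rabs continuous_on_inner_field) auto
  have "closed T"
    unfolding T_def
    by (intro continuous_on_closed_Collect_le continuous_on_const cf compact_imp_closed[OF cB])
  moreover have "T \<subseteq> B \<inter> closure \<Omega>"
    by (auto simp: T_def)
  ultimately have cT: "compact T"
    using cB closed_subset compact_Int_closed[of "B \<inter> closure \<Omega>" T] by (simp add: Int_absorb1)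
  have neg: "\<rho> y < 0" if "y \<in> T" for y
  proof (rule ccontr)
    assume "\<not> \<rho> y < 0"
    then have "y \<notin> \<Omega>" and yV: "y \<in> V"
      using that \<Omega>V B(2) by (auto simp: T_def)
    then have "y \<in> frontier \<Omega>"
      using that open_domain by (auto simp: T_def frontier_def interior_open)
    then have "outer_normal \<Omega> y (gradient \<rho> y /\<^sub>R norm (gradient \<rho> y))"
      unfolding outer_normal_def using \<rho> \<Omega>V yV by blast
    from tangential[OF this] have "gradient \<rho> y \<bullet> X y = 0"
      using \<rho>(3)[OF yV] by (simp add: inner_commute)
    then show False
      using that \<open>e > 0\<close> by (simp add: T_def)
  qed
  show thesis
  proof (cases "T = {}")
    case True
    show thesis
      by (rule that[of 1]) (use True closure_subset[of \<Omega>] in \<open>force simp: T_def not_le\<close>)+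
  next
    case False
    have "continuous_on T \<rho>"
      by (rule continuous_on_subset[OF C1_on_continuous[OF \<rho>(1)]])
         (use B(2) in \<open>auto simp: T_def\<close>)
    then obtain z where z: "z \<in> T" "\<And>y. y \<in> T \<Longrightarrow> \<rho> y \<le> \<rho> z"
      using continuous_attains_sup[OF cT False] by blast
    show thesis
    proof (rule that[of "- \<rho> z"])
      show "- \<rho> z > 0" using neg[OF z(1)] by simp
      fix y assume y: "y \<in> B" "y \<in> \<Omega>" "- (- \<rho> z) < \<rho> y"
      then have "y \<notin> T" using z(2)[of y] by auto
      with y show "?f y < e"
        using closure_subset[of \<Omega>] by (auto simp: T_def)
    qed
  qed
qed

text \<open>Let \<open>s\<close> be the step that cuts off the boundary layer of width \<open>1/k\<close>. Then \<open>\<eta> s\<close> has compact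
support in the domain, so its flux is zero, and by the product rule \<open>\<integral> s (\<eta> div X + \<nabla>\<eta> \<bullet> X)\<close>
equals the integral over the layer that appears in the statement. As \<open>k \<rightarrow> \<infinity>\<close> the former tends
to \<open>flux \<eta>\<close> by dominated convergence.\<close>

lemma flux_boundary_layer_limit:
  assumes C1: "C1_on UNIV \<eta>" and \<rho>: "C1_on V \<rho>" "open V" "cball z r \<subseteq> V" and r: "r > 0"
    and \<Omega>V: "\<Omega> \<inter> V = {y \<in> V. \<rho> y < 0}" and supp: "\<And>y. r \<le> dist z y \<Longrightarrow> \<eta> y = 0"
  shows "(\<lambda>n. LINT y:\<Omega>|lebesgue. \<eta> y * (real (Suc n) * smooth_step' (- (real (Suc n) * \<rho> y) - 1))
      * (gradient \<rho> y \<bullet> X y)) \<longlonglongrightarrow> flux \<eta>"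
    and "\<And>k. set_integrable lebesgue \<Omega>
      (\<lambda>y. \<eta> y * (k * smooth_step' (- (k * \<rho> y) - 1)) * (gradient \<rho> y \<bullet> X y))"
proof -
  let ?B = "cball z r"
  define s where "s = (\<lambda>k y. smooth_step (- (k * \<rho> y) - 1))"
  define s' where "s' = (\<lambda>k y. k * smooth_step' (- (k * \<rho> y) - 1))"
  define g where "g = (\<lambda>k y. \<eta> y * s' k y * (gradient \<rho> y \<bullet> X y))"
  define P where "P = (\<lambda>y. \<eta> y * divergence X y + gradient \<eta> y \<bullet> X y)"
  have \<eta>0: "\<eta> y = 0" if "y \<notin> ?B" for y
    using that by (intro supp) auto
  have G\<eta>0: "gradient \<eta> y = 0" if "y \<notin> ?B" for y
    using that \<eta>0 by (intro gradient_zero_open[of "- ?B"]) auto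
  have C1V: "C1_on V \<eta>"
    using C1_on_subset[OF C1] by auto
  have C1s: "C1_on V (s k)" for k
    unfolding s_def using C1_on_compose[OF \<rho>(1) DERIV_boundary_step continuous_on_boundary_step'] .
  have grad_s: "gradient (s k) y = - s' k y *\<^sub>R gradient \<rho> y" if "y \<in> V" for k y
    using gradient_compose[OF \<rho>(1) DERIV_boundary_step that] by (simp add: s_def s'_def)
  have C1_prod: "C1_on UNIV (\<lambda>y. \<eta> y * s k y)" for k
    by (rule C1_on_extend_zero[OF \<rho>(2) closed_cball \<rho>(3) C1_on_mult[OF C1V C1s]])
       (simp add: \<eta>0)
  have id: "\<eta> y * s k y * divergence X y + gradient (\<lambda>y. \<eta> y * s k y) y \<bullet> X y = s k y * P y - g k y"
    for k y
  proof (cases "y \<in> ?B")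
    case True
    then have y: "y \<in> V" using \<rho>(3) by blast
    show ?thesis
      by (simp add: gradient_mult[OF C1V C1s y] grad_s[OF y] P_def g_def algebra_simps)
  next
    case False
    have "gradient (\<lambda>y. \<eta> y * s k y) y = 0"
      using False \<eta>0 by (intro gradient_zero_open[of "- ?B"]) auto
    then show ?thesis
      using \<eta>0[OF False] G\<eta>0[OF False] by (simp add: P_def g_def)
  qed
  \<comment> \<open>On the support of \<open>\<eta> s\<close> the defining function is at most \<open>- 1/k\<close>.\<close>
  have flux0: "flux (\<lambda>y. \<eta> y * s k y) = 0" if "k > 0" for k
  proof (rule flux_compact_support[OF C1_prod])
    let ?K = "{y \<in> ?B. \<rho> y \<le> - (1 / k)}"
    have "closed ?K"
      by (intro continuous_on_closed_Collect_le continuous_on_const closed_cball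
          continuous_on_subset[OF C1_on_continuous[OF \<rho>(1)] \<rho>(3)])
    then show "compact ?K"
      using compact_Int_closed[of ?B ?K] by (simp add: Int_def conj_ac)
    have "- (1 / k) < 0" using that by simp
    then have "?K \<subseteq> {y \<in> V. \<rho> y < 0}"
      using \<rho>(3) by (auto intro: le_less_trans)
    then show "?K \<subseteq> \<Omega>"
      using \<Omega>V by blast
    fix y assume "y \<notin> ?K"
    show "\<eta> y * s k y = 0"
    proof (cases "y \<in> ?B")
      case True
      with \<open>y \<notin> ?K\<close> have "- (1 / k) < \<rho> y" by auto
      from mult_strict_left_mono[OF this that] have "- (k * \<rho> y) - 1 \<le> 0"
        using that by simp
      then show ?thesis by (simp add: s_def smooth_step_eq)
    qed (simp add: \<eta>0)
  qed
  have int_g: "set_integrable lebesgue \<Omega> (g k)" for k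
  proof -
    let ?K = "?B \<inter> closure \<Omega>"
    have K: "compact ?K" "?K \<subseteq> V"
      using compact_closure_domain \<rho>(3) by (auto intro: compact_Int)
    have "continuous_on ?K (g k)"
      unfolding g_def s'_def
      by (intro continuous_intros continuous_on_inner_field
          continuous_on_compose2[OF continuous_on_smooth_step'[of UNIV]]
          continuous_on_subset[OF C1_on_continuous_gradient[OF \<rho>(1)] K(2)]
          continuous_on_subset[OF C1_on_continuous[OF \<rho>(1)] K(2)]
          continuous_on_subset[OF C1_on_continuous[OF C1]]) auto
    define f where "f = (\<lambda>y. if y \<in> ?K then g k y else 0)"
    have "continuous_on ?K f"
      using \<open>continuous_on ?K (g k)\<close> by (rule continuous_on_eq) (simp add: f_def)
    then have "integrable lebesgue f"
      by (rule integrable_continuous_compact_support[OF K(1)]) (simp only: f_def if_False)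
    then have "set_integrable lebesgue UNIV f"
      by (simp add: set_integrable_def)
    then have "set_integrable lebesgue \<Omega> f"
      by (rule set_integrable_subset) (use open_domain in auto)
    moreover have "f y = g k y" if "y \<in> \<Omega>" for y
      using that closure_subset[of \<Omega>] \<eta>0[of y] by (auto simp: f_def g_def)
    ultimately show ?thesis
      using set_integrable_cong[OF refl refl, of \<Omega> f "g k" lebesgue] by blast
  qed
  then show "\<And>k. set_integrable lebesgue \<Omega>
      (\<lambda>y. \<eta> y * (k * smooth_step' (- (k * \<rho> y) - 1)) * (gradient \<rho> y \<bullet> X y))"
    by (simp add: g_def s'_def)
  have int_P: "set_integrable lebesgue \<Omega> P"
    unfolding P_def
    by (intro set_integral_add(1) integrable_mult_divergence integrable_gradient_inner C1)
  have int_sP: "set_integrable lebesgue \<Omega> (\<lambda>y. s k y * P y)" for k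
  proof -
    have "set_integrable lebesgue \<Omega> (\<lambda>y. s k y * P y - g k y)"
      unfolding id[symmetric]
      by (intro set_integral_add(1) integrable_mult_divergence integrable_gradient_inner C1_prod)
    from set_integral_add(1)[OF this int_g[of k]] show ?thesis by simp
  qed
  have eq: "(LINT y:\<Omega>|lebesgue. s k y * P y) = (LINT y:\<Omega>|lebesgue. g k y)" if "k > 0" for k
  proof -
    have "0 = (LINT y:\<Omega>|lebesgue. s k y * P y - g k y)"
      using flux0[OF that] unfolding flux_def id by simp
    then show ?thesis
      using int_sP int_g by simp
  qed
  have "(\<lambda>n. LINT y:\<Omega>|lebesgue. s (real (Suc n)) y * P y) \<longlonglongrightarrow> (LINT y:\<Omega>|lebesgue. P y)"
    unfolding set_lebesgue_integral_def
  proof (rule integral_dominated_convergence[where w = "\<lambda>y. norm (indicator \<Omega> y *\<^sub>R P y)"])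
    show "integrable lebesgue (\<lambda>y. norm (indicator \<Omega> y *\<^sub>R P y))"
      using int_P unfolding set_integrable_def by (rule integrable_norm)
    show "(\<lambda>y. indicator \<Omega> y *\<^sub>R P y) \<in> borel_measurable lebesgue"
      using int_P unfolding set_integrable_def by (rule borel_measurable_integrable)
    show "(\<lambda>y. indicator \<Omega> y *\<^sub>R (s (real (Suc n)) y * P y)) \<in> borel_measurable lebesgue" for n
      using int_sP unfolding set_integrable_def by (rule borel_measurable_integrable)
    have "norm (s k y * P y) \<le> norm (P y)" for k y
      using mult_right_mono[of "\<bar>s k y\<bar>" 1 "\<bar>P y\<bar>"] smooth_step_bounds
      by (simp add: s_def abs_mult)
    then show "AE y in lebesgue. norm (indicator \<Omega> y *\<^sub>R (s (real (Suc n)) y * P y))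
        \<le> norm (indicator \<Omega> y *\<^sub>R P y)" for n
      by (intro always_eventually allI) (simp add: indicator_def)
    have "(\<lambda>n. s (real (Suc n)) y * P y) \<longlonglongrightarrow> P y" if y: "y \<in> \<Omega>" for y
    proof (cases "y \<in> ?B")
      case True
      then have neg: "\<rho> y < 0"
        using y \<rho>(3) \<Omega>V by blast
      \<comment> \<open>For \<open>k > 2 / (- \<rho> y)\<close> the point \<open>y\<close> lies below the layer, where the step is 1.\<close>
      obtain N :: nat where N: "2 / (- \<rho> y) < N"
        using reals_Archimedean2 by blast
      have "s (real (Suc n)) y * P y = P y" if "n \<ge> N" for n
      proof -
        have "2 / (- \<rho> y) < real (Suc n)" using N that by linarith
        then have "2 < real (Suc n) * (- \<rho> y)"
          using neg by (simp only: pos_divide_less_eq neg_0_less_iff_less)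
        then show ?thesis
          by (simp add: s_def smooth_step_eq)
      qed
      then show ?thesis
        by (intro tendsto_eventually) (auto simp: eventually_sequentially)
    next
      case False
      then have "P y = 0"
        using \<eta>0 G\<eta>0 by (simp add: P_def)
      then show ?thesis by simp
    qed
    then show "AE y in lebesgue. (\<lambda>n. indicator \<Omega> y *\<^sub>R (s (real (Suc n)) y * P y))
        \<longlonglongrightarrow> indicator \<Omega> y *\<^sub>R P y"
      by (intro always_eventually allI) (auto simp: indicator_def)
  qed
  then show "(\<lambda>n. LINT y:\<Omega>|lebesgue. \<eta> y * (real (Suc n) * smooth_step' (- (real (Suc n) * \<rho> y) - 1))
      * (gradient \<rho> y \<bullet> X y)) \<longlonglongrightarrow> flux \<eta>"
    using eq[of "real (Suc n)" for n] by (simp add: flux_def P_def g_def s'_def)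
qed

section \<open>Localization of the flux\<close>

text \<open>The factor 2 leaves room for a bump that equals 1 on the ball of radius \<open>r\<close>, as the covering
argument requires.\<close>

definition locally_flux_free :: "real ^ 'n \<Rightarrow> real \<Rightarrow> bool" where
  "locally_flux_free z r \<longleftrightarrow> r > 0 \<and>
     (\<forall>\<eta>. C1_on UNIV \<eta> \<longrightarrow> (\<forall>y. 2 * r \<le> dist z y \<longrightarrow> \<eta> y = 0) \<longrightarrow> flux \<eta> = 0)"

lemma locally_flux_free_interior:
  assumes "z \<in> \<Omega>"
  shows "\<exists>r. locally_flux_free z r"
proof -
  obtain R where R: "R > 0" "cball z R \<subseteq> \<Omega>"
    using open_domain assms open_contains_cball by blast
  have "flux \<eta> = 0" if "C1_on UNIV \<eta>" "\<forall>y. R \<le> dist z y \<longrightarrow> \<eta> y = 0" for \<eta>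
    by (rule flux_compact_support[OF that(1) compact_cball R(2)]) (use that(2) in auto)
  then have "locally_flux_free z (R / 2)"
    using R(1) by (simp add: locally_flux_free_def)
  then show ?thesis ..
qed

text \<open>In the layer integral that approximates \<open>flux \<eta>\<close> the factor \<open>\<nabla>\<rho> \<bullet> X\<close> is eventually smaller
than any \<open>e\<close>, and the remaining factors have bounded integral.\<close>

lemma locally_flux_free_regular_boundary:
  assumes "outer_normal \<Omega> z \<nu>"
  shows "\<exists>r. locally_flux_free z r"
proof -
  obtain V \<rho> where \<rho>: "open V" "z \<in> V" "C1_on V \<rho>" "\<And>y. y \<in> V \<Longrightarrow> gradient \<rho> y \<noteq> 0"
      "\<Omega> \<inter> V = {y \<in> V. \<rho> y < 0}"
    using assms unfolding outer_normal_def by blast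
  obtain i where i: "gradient \<rho> z $ i \<noteq> 0"
    using \<rho>(4)[OF \<rho>(2)] by (auto simp: vec_eq_iff)
  \<comment> \<open>The sign \<open>\<sigma>\<close> makes the chosen partial derivative of \<open>\<rho>\<close> positive.\<close>
  define \<sigma> where "\<sigma> = sgn (gradient \<rho> z $ i)"
  define c where "c = \<bar>gradient \<rho> z $ i\<bar> / 2"
  have c: "c > 0" "\<bar>\<sigma>\<bar> = 1" "c < \<sigma> * gradient \<rho> z $ i"
    using i by (auto simp: c_def \<sigma>_def sgn_if)
  let ?f = "\<lambda>y. \<sigma> * gradient \<rho> y $ i"
  have "open (V \<inter> ?f -` {c<..})"
    by (intro continuous_open_preimage continuous_intros C1_on_continuous_gradient \<rho>(1,3))
  then obtain R where R: "R > 0" "cball z R \<subseteq> V \<inter> ?f -` {c<..}"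
    using c(3) \<rho>(2) open_contains_cball by (metis (no_types, lifting) IntI greaterThan_iff vimageI2)
  \<comment> \<open>The support of \<open>\<eta>\<close> has radius \<open>2r\<close>; the bump that equals 1 there has radius \<open>2r\<close> and support of radius \<open>4r = R\<close>.\<close>
  define r where "r = R / 4"
  have r: "r > 0" "2 * (2 * r) = R"
    using R(1) by (auto simp: r_def)
  have cb: "c \<le> ?f y" if "y \<in> cball z (2 * (2 * r))" for y
    using R(2) that unfolding r(2) by force
  obtain M where M: "M \<ge> 0"
    "\<And>k. k > 0 \<Longrightarrow> integrable lebesgue (\<lambda>y. bump z (2 * r) y * (k * smooth_step' (- (k * \<rho> y) - 1)))"
    "\<And>k. k > 0 \<Longrightarrow> (LINT y|lebesgue. bump z (2 * r) y * (k * smooth_step' (- (k * \<rho> y) - 1))) \<le> M"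
  proof (rule boundary_layer_mass_bounded[OF \<rho>(3) \<rho>(1) _ _ c(1,2) cb])
    show "cball z (2 * (2 * r)) \<subseteq> V"
      unfolding r(2) using R(2) by blast
  qed (use r(1) in auto)
  have BV: "cball z (2 * r) \<subseteq> V"
    using R r subset_cball[of "2 * r" R z] by auto
  have "flux \<eta> = 0" if \<eta>: "C1_on UNIV \<eta>" "\<forall>y. 2 * r \<le> dist z y \<longrightarrow> \<eta> y = 0" for \<eta>
  proof -
    define s' where "s' = (\<lambda>n y. real (Suc n) * smooth_step' (- (real (Suc n) * \<rho> y) - 1))"
    define I where "I = (\<lambda>n. LINT y:\<Omega>|lebesgue. \<eta> y * s' n y * (gradient \<rho> y \<bullet> X y))"
    have s'0: "0 \<le> s' n y" for n y
      using smooth_step'_bounds(1) by (simp add: s'_def)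
    have supp: "\<And>y. 2 * r \<le> dist z y \<Longrightarrow> \<eta> y = 0"
      using \<eta>(2) by blast
    note layer = flux_boundary_layer_limit[OF \<eta>(1) \<rho>(3,1) BV _ \<rho>(5) supp]
    have lim: "I \<longlonglongrightarrow> flux \<eta>"
      using layer(1) r(1) by (simp add: I_def s'_def)
    have "bounded (\<eta> ` cball z (2 * r))"
      by (intro compact_imp_bounded compact_continuous_image compact_cball
          continuous_on_subset[OF C1_on_continuous[OF \<eta>(1)]]) auto
    then obtain C where C: "\<And>y. y \<in> cball z (2 * r) \<Longrightarrow> \<bar>\<eta> y\<bar> \<le> C"
      by (auto simp: bounded_iff simp del: mem_cball)
    have C0: "C \<ge> 0"
      using C[of z] r(1) by simp
    have bound: "\<bar>flux \<eta>\<bar> \<le> C * e * M" if "e > 0" for e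
    proof -
      obtain h where h: "h > 0"
        "\<And>y. y \<in> cball z (2 * r) \<Longrightarrow> y \<in> \<Omega> \<Longrightarrow> - h < \<rho> y \<Longrightarrow> \<bar>gradient \<rho> y \<bullet> X y\<bar> < e"
        using normal_component_small_near_boundary
          [OF \<rho>(3,1,4,5) compact_cball BV \<open>e > 0\<close>] by blast
      obtain N :: nat where N: "2 / h < N"
        using reals_Archimedean2 by blast
      have le: "\<bar>I n\<bar> \<le> C * e * M" if "n \<ge> N" for n
      proof -
        have "2 / h < real (Suc n)"
          using N that by linarith
        then have k: "2 < real (Suc n) * h"
          using h(1) by (simp add: pos_divide_less_eq)
        have int: "integrable lebesgue (\<lambda>y. C * e * (bump z (2 * r) y * s' n y))"
          using M(2)[of "real (Suc n)"] by (simp add: s'_def)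
        have pw: "\<bar>\<eta> y * s' n y * (gradient \<rho> y \<bullet> X y)\<bar> \<le> C * e * (bump z (2 * r) y * s' n y)"
          if "y \<in> \<Omega>" for y
        proof (cases "y \<in> cball z (2 * r) \<and> s' n y \<noteq> 0")
          case True
          then have "- (real (Suc n) * \<rho> y) - 1 < 1"
            using smooth_step'_eq_0[of "- (real (Suc n) * \<rho> y) - 1"] by (force simp: s'_def)
          then have "real (Suc n) * (- h) < real (Suc n) * \<rho> y"
            using k by simp
          then have "- h < \<rho> y"
            by (rule mult_left_less_imp_less) simp
          then have e: "\<bar>gradient \<rho> y \<bullet> X y\<bar> \<le> e"
            using h(2)[of y] True that by simp
          have b: "bump z (2 * r) y = 1"
            using True r(1) by (intro bump_eq_1) auto
          have "\<bar>\<eta> y * s' n y * (gradient \<rho> y \<bullet> X y)\<bar> = \<bar>\<eta> y\<bar> * s' n y * \<bar>gradient \<rho> y \<bullet> X y\<bar>"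
            using s'0 by (simp add: abs_mult)
          also have "\<dots> \<le> C * s' n y * e"
            using C True e s'0 C0 by (intro mult_mono mult_nonneg_nonneg) auto
          finally show ?thesis
            unfolding b by (simp add: mult_ac)
        next
          case False
          then have "\<eta> y * s' n y = 0"
            using supp[of y] by force
          moreover have "0 \<le> C * e * (bump z (2 * r) y * s' n y)"
            using C0 \<open>e > 0\<close> s'0 bump_bounds(1) by (intro mult_nonneg_nonneg) auto
          ultimately show ?thesis
            by (simp only: mult_zero_left abs_zero)
        qed
        have "\<bar>I n\<bar> \<le> (LINT y|lebesgue. C * e * (bump z (2 * r) y * s' n y))"
          unfolding I_def
        proof (rule abs_set_integral_le_integral[OF _ int pw])
          show "set_integrable lebesgue \<Omega> (\<lambda>y. \<eta> y * s' n y * (gradient \<rho> y \<bullet> X y))"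
            using layer(2)[of "real (Suc n)"] r(1) by (simp add: s'_def)
          show "0 \<le> C * e * (bump z (2 * r) y * s' n y)" for y
            using C0 \<open>e > 0\<close> s'0 bump_bounds(1) by (intro mult_nonneg_nonneg) auto
        qed
        also have "\<dots> = C * e * (LINT y|lebesgue. bump z (2 * r) y * s' n y)"
          by simp
        also have "\<dots> \<le> C * e * M"
          using M(3)[of "real (Suc n)"] C0 \<open>e > 0\<close> by (intro mult_left_mono) (auto simp: s'_def)
        finally show ?thesis .
      qed
      show ?thesis
        by (rule LIMSEQ_le_const2[OF tendsto_rabs[OF lim]]) (use le in blast)
    qed
    show "flux \<eta> = 0"
    proof (rule ccontr)
      assume *: "flux \<eta> \<noteq> 0"
      have CM: "C * M \<ge> 0" using C0 M(1) by simp
      \<comment> \<open>Chosen so that \<open>C e M\<close> is less than \<open>|flux \<eta>|\<close>, also if \<open>C M = 0\<close>.\<close>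
      define e where "e = \<bar>flux \<eta>\<bar> / (2 * (C * M + 1))"
      have "e > 0" using * CM by (simp add: e_def)
      have "C * e * M = \<bar>flux \<eta>\<bar> / 2 * (C * M / (C * M + 1))"
        by (simp add: e_def)
      also have "\<dots> \<le> \<bar>flux \<eta>\<bar> / 2 * 1"
        using CM by (intro mult_left_mono) auto
      finally show False
        using bound[OF \<open>e > 0\<close>] * by simp
    qed
  qed
  then have "locally_flux_free z r"
    using r(1) unfolding locally_flux_free_def by blast
  then show ?thesis ..
qed

text \<open>A partition of unity without division: the bump \<open>\<psi>\<close> of one ball splits \<open>\<eta> = \<eta> \<psi> + \<eta> (1 - \<psi>)\<close>.
The first part is supported near that ball, and the second one vanishes on it, so that it
is covered by the remaining balls.\<close>

lemma flux_eq_0_if_covered: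
  assumes "finite T" "\<And>c. c \<in> T \<Longrightarrow> locally_flux_free c (r c)" "C1_on UNIV \<eta>"
    and "\<And>y. y \<in> \<Omega> \<Longrightarrow> y \<notin> (\<Union>c\<in>T. cball c (r c)) \<Longrightarrow> \<eta> y = 0"
  shows "flux \<eta> = 0"
  using assms
proof (induction T arbitrary: \<eta> rule: finite_induct)
  case empty
  then have "gradient \<eta> y = 0" if "y \<in> \<Omega>" for y
    using that gradient_zero_open[OF open_domain, of y \<eta>] by simp
  then have "flux \<eta> = (LINT y:\<Omega>|lebesgue. 0)"
    unfolding flux_def using open_domain empty by (intro set_lebesgue_integral_cong) auto
  then show ?case by simp
next
  case (insert c T)
  let ?\<psi> = "bump c (r c)"
  have r: "r c > 0" and free: "\<And>\<zeta>. C1_on UNIV \<zeta> \<Longrightarrow> (\<And>y. 2 * r c \<le> dist c y \<Longrightarrow> \<zeta> y = 0) \<Longrightarrow> flux \<zeta> = 0"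
    using insert.prems(1)[of c] by (auto simp: locally_flux_free_def)
  have C1: "C1_on UNIV (\<lambda>y. \<eta> y * ?\<psi> y)" "C1_on UNIV (\<lambda>y. \<eta> y * (1 - ?\<psi> y))"
    using insert.prems(2) C1_on_bump[OF r] by (auto intro!: C1_on_mult C1_on_diff C1_on_const)
  have "flux \<eta> = flux (\<lambda>y. \<eta> y * ?\<psi> y + \<eta> y * (1 - ?\<psi> y))"
    by (intro flux_cong) (simp add: algebra_simps)
  also have "\<dots> = flux (\<lambda>y. \<eta> y * ?\<psi> y) + flux (\<lambda>y. \<eta> y * (1 - ?\<psi> y))"
    by (rule flux_add[OF C1])
  also have "flux (\<lambda>y. \<eta> y * ?\<psi> y) = 0"
    by (rule free[OF C1(1)]) (simp add: bump_eq_0[OF r])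
  also have "flux (\<lambda>y. \<eta> y * (1 - ?\<psi> y)) = 0"
  proof (rule insert.IH[OF _ C1(2)])
    fix y assume "y \<in> \<Omega>" "y \<notin> (\<Union>c\<in>T. cball c (r c))"
    then show "\<eta> y * (1 - ?\<psi> y) = 0"
      using insert.prems(3)[of y] bump_eq_1[OF r, of c y] by (cases "dist c y \<le> r c") auto
  qed (use insert.prems(1) in auto)
  finally show ?case by simp
qed

text \<open>The part of the closed domain outside \<open>W\<close> is compact and consists of interior points and
regular boundary points, so that finitely many balls with locally vanishing flux cover it.\<close>

lemma flux_eq_0_off_singular_boundary:
  assumes C1: "C1_on UNIV \<eta>" and W: "open W" "singular_boundary \<Omega> \<subseteq> W" "\<And>y. y \<in> W \<Longrightarrow> \<eta> y = 0"
  shows "flux \<eta> = 0"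
proof -
  let ?K = "closure \<Omega> - W"
  have K: "compact ?K"
    using compact_closure_domain W(1) by (simp add: compact_diff)
  have "\<exists>r. locally_flux_free z r" if "z \<in> ?K" for z
  proof (cases "z \<in> \<Omega>")
    case False
    then have "z \<in> frontier \<Omega>"
      using that open_domain by (auto simp: frontier_def interior_open)
    then have "\<exists>\<nu>. outer_normal \<Omega> z \<nu>"
      using that W(2) by (auto simp: singular_boundary_def)
    then obtain \<nu> where "outer_normal \<Omega> z \<nu>" ..
    then show ?thesis
      by (rule locally_flux_free_regular_boundary)
  qed (rule locally_flux_free_interior)
  then obtain r where r: "\<And>z. z \<in> ?K \<Longrightarrow> locally_flux_free z (r z)"
    by metis
  have "?K \<subseteq> (\<Union>z\<in>?K. ball z (r z))"
    using r by (force simp: locally_flux_free_def)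
  then obtain T where T: "T \<subseteq> ?K" "finite T" "?K \<subseteq> (\<Union>z\<in>T. ball z (r z))"
    using compactE_image[OF K, of ?K "\<lambda>z. ball z (r z)"] by auto
  show ?thesis
  proof (rule flux_eq_0_if_covered[OF T(2) _ C1])
    show "locally_flux_free c (r c)" if "c \<in> T" for c
      using r T(1) that by blast
    fix y assume y: "y \<in> \<Omega>" "y \<notin> (\<Union>c\<in>T. cball c (r c))"
    then have "y \<notin> ?K"
      using T(3) ball_subset_cball by blast
    then show "\<eta> y = 0"
      using y(1) closure_subset[of \<Omega>] W(3) by blast
  qed
qed

end

section \<open>Cutoffs for small singular sets\<close>

text \<open>A maximal \<open>r\<close>-separated subset of \<open>S\<close>: by maximality the balls of radius \<open>r\<close> cover \<open>S\<close>, and the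
balls of half that radius are disjoint, which bounds their number by the volume of the
neighbourhood of radius \<open>r/2\<close>.\<close>

lemma separated_net:
  fixes S :: "(real ^ 'n) set"
  assumes "bounded S" "r > 0"
  obtains T where "finite T" "T \<subseteq> S" "S \<subseteq> (\<Union>c\<in>T. ball c r)"
    and "real (card T) * measure lebesgue (ball (0 :: real ^ 'n) (r / 2))
      \<le> measure lebesgue (\<Union>x\<in>S. ball x (r / 2))"
proof -
  let ?v = "measure lebesgue (ball (0 :: real ^ 'n) (r / 2))"
  let ?N = "\<Union>x\<in>S. ball x (r / 2)"
  define sep where "sep T \<longleftrightarrow> finite T \<and> T \<subseteq> S \<and> (\<forall>x\<in>T. \<forall>y\<in>T. x \<noteq> y \<longrightarrow> r \<le> dist x y)" for T
  have v: "?v > 0"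
    using assms by simp
  have vc: "measure lebesgue (ball c (r / 2)) = ?v" for c :: "real ^ 'n"
    using assms by (simp add: content_ball)
  obtain R where R: "\<And>x. x \<in> S \<Longrightarrow> norm x \<le> R"
    using assms(1) bounded_iff by blast
  have "?N \<subseteq> ball 0 (R + r)"
  proof
    fix y assume "y \<in> ?N"
    then obtain x where "x \<in> S" "dist x y < r / 2" by auto
    then have "norm y < R + r"
      using R[of x] norm_triangle_sub[of y x] assms(2) by (simp add: dist_norm norm_minus_commute)
    then show "y \<in> ball 0 (R + r)" by simp
  qed
  then have "bounded ?N"
    using bounded_ball bounded_subset by blast
  then have N: "?N \<in> lmeasurable"
    by (intro lmeasurable_open) auto
  have card: "real (card T) * ?v \<le> measure lebesgue ?N" if "sep T" for T
  proof -
    have "disjoint_family_on (\<lambda>c. ball c (r / 2)) T"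
      unfolding disjoint_family_on_def
    proof (intro ballI impI)
      fix x y assume "x \<in> T" "y \<in> T" "x \<noteq> y"
      then have "r \<le> dist x y"
        using that by (auto simp: sep_def)
      then show "ball x (r / 2) \<inter> ball y (r / 2) = {}"
        by (intro disjoint_ballI) auto
    qed
    then have "measure lebesgue (\<Union>c\<in>T. ball c (r / 2)) = (\<Sum>c\<in>T. measure lebesgue (ball c (r / 2)))"
      using that by (intro measure_finite_Union) 
        (use emeasure_lborel_ball_finite in \<open>auto simp: sep_def less_top[symmetric]\<close>)
    also have "\<dots> = (\<Sum>c\<in>T. ?v)"
      by (intro sum.cong refl vc)
    also have "\<dots> = real (card T) * ?v"
      by (rule sum_constant)
    finally have "real (card T) * ?v = measure lebesgue (\<Union>c\<in>T. ball c (r / 2))" ..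
    also have "\<dots> \<le> measure lebesgue ?N"
      using that N by (intro measure_mono_fmeasurable) (auto simp: sep_def intro!: sets.finite_UN)
    finally show ?thesis .
  qed
  obtain b :: nat where b: "measure lebesgue ?N / ?v < b"
    using reals_Archimedean2 by blast
  have le: "card T < b" if "sep T" for T
  proof -
    have "real (card T) \<le> measure lebesgue ?N / ?v"
      using card[OF that] v by (simp only: pos_le_divide_eq)
    then show ?thesis using b by linarith
  qed
  have "sep {}"
    by (simp add: sep_def)
  then have "\<exists>T. sep T \<and> (\<forall>T'. sep T' \<longrightarrow> card T' \<le> card T)"
    by (rule ex_has_greatest_nat[where b = b]) (use le in auto)
  then obtain T where T: "sep T" "\<And>T'. sep T' \<Longrightarrow> card T' \<le> card T"
    by blast
  show thesis
  proof (rule that[of T])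
    show "finite T" "T \<subseteq> S"
      using T(1) by (auto simp: sep_def)
    show "S \<subseteq> (\<Union>c\<in>T. ball c r)"
    proof (rule ccontr)
      assume "\<not> S \<subseteq> (\<Union>c\<in>T. ball c r)"
      then obtain x where x: "x \<in> S" "\<And>c. c \<in> T \<Longrightarrow> r \<le> dist c x"
        by (force simp: not_less[symmetric])
      then have "sep (insert x T)"
        using T(1) by (auto simp: sep_def dist_commute)
      moreover have "x \<notin> T"
        using x(2)[of x] assms(2) by auto
      ultimately show False
        using T(2)[of "insert x T"] T(1) by (simp add: sep_def)
    qed
  qed (rule card[OF T(1)])
qed

lemma prod_unit_interval:
  fixes u :: "'a \<Rightarrow> real"
  assumes "\<And>c. c \<in> T \<Longrightarrow> 0 \<le> u c \<and> u c \<le> 1"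
  shows "0 \<le> (\<Prod>c\<in>T. u c) \<and> (\<Prod>c\<in>T. u c) \<le> 1"
  using assms by (auto intro: prod_nonneg prod_le_1)

lemma norm_gradient_prod_le:
  assumes "finite T" "\<And>c. c \<in> T \<Longrightarrow> C1_on UNIV (u c)"
    and "\<And>c x. c \<in> T \<Longrightarrow> 0 \<le> u c x \<and> u c x \<le> 1"
  shows "norm (gradient (\<lambda>x. \<Prod>c\<in>T. u c x) x) \<le> (\<Sum>c\<in>T. norm (gradient (u c) x))"
  using assms
proof (induction T rule: finite_induct)
  case empty
  then show ?case
    using gradient_eq[OF GDERIV_const, of "1::real" x] by simp
next
  case (insert c T)
  let ?p = "\<lambda>x. \<Prod>c\<in>T. u c x"
  have "norm (gradient (\<lambda>x. u c x * ?p x) x) = norm (u c x *\<^sub>R gradient ?p x + ?p x *\<^sub>R gradient (u c) x)"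
    using insert.prems(1) by (subst gradient_mult[of UNIV]) (auto intro: C1_on_prod)
  also have "\<dots> \<le> \<bar>u c x\<bar> * norm (gradient ?p x) + \<bar>?p x\<bar> * norm (gradient (u c) x)"
    by (rule order_trans[OF norm_triangle_ineq]) simp
  also have "\<dots> \<le> 1 * norm (gradient ?p x) + 1 * norm (gradient (u c) x)"
    using insert.prems(2) prod_unit_interval[of T "\<lambda>c. u c x"]
    by (intro add_mono mult_right_mono) auto
  also have "norm (gradient ?p x) \<le> (\<Sum>c\<in>T. norm (gradient (u c) x))"
    using insert by simp
  finally show ?case
    using insert.hyps by simp
qed

text \<open>The gradient is at most \<open>6/r\<close> on a ball of radius \<open>2r\<close>. The bound is expressed by the ball of
radius \<open>r/2\<close>, whose volume is smaller by the factor \<open>4\<^sup>d\<close> and which is the one counted in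
\<open>separated_net\<close>.\<close>

lemma integral_norm_gradient_bump_le:
  fixes c :: "real ^ 'n"
  assumes "r > 0"
  shows "integrable lebesgue (\<lambda>x. norm (gradient (bump c r) x))"
    and "(LINT x|lebesgue. norm (gradient (bump c r) x))
      \<le> 3 * 4 ^ CARD('n) / (r / 2) * measure lebesgue (ball (0 :: real ^ 'n) (r / 2))"
proof -
  let ?B = "cball c (2 * r)"
  have zero: "gradient (bump c r) x = 0" if "x \<notin> ?B" for x
    using that by (intro gradient_bump_eq_0[OF assms]) auto
  show int: "integrable lebesgue (\<lambda>x. norm (gradient (bump c r) x))"
    by (rule integrable_continuous_compact_support[of ?B])
       (auto intro!: continuous_intros C1_on_continuous_gradient C1_on_bump assms simp: zero)
  have "(LINT x|lebesgue. norm (gradient (bump c r) x)) \<le> (LINT x|lebesgue. 6 / r * indicator ?B x)"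
  proof (rule integral_mono[OF int])
    show "integrable lebesgue (\<lambda>x. 6 / r * indicator ?B x)"
      using lmeasurable_cball[of c "2 * r"] by (simp add: lmeasurable_iff_integrable)
    show "norm (gradient (bump c r) x) \<le> 6 / r * indicator ?B x" for x
      using norm_gradient_bump_le[OF assms, of c x] zero[of x] by (cases "x \<in> ?B") auto
  qed
  also have "\<dots> = 6 / r * measure lebesgue ?B"
    by simp
  also have "measure lebesgue ?B = 4 ^ CARD('n) * measure lebesgue (ball (0 :: real ^ 'n) (r / 2))"
  proof -
    have "(2 * r) ^ CARD('n) = (4 * (r / 2)) ^ CARD('n)"
      by simp
    then have "(2 * r) ^ CARD('n) = 4 ^ CARD('n) * (r / 2) ^ CARD('n)"
      by (simp only: power_mult_distrib)
    then show ?thesis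
      using assms by (simp add: content_ball content_cball)
  qed
  finally show "(LINT x|lebesgue. norm (gradient (bump c r) x))
      \<le> 3 * 4 ^ CARD('n) / (r / 2) * measure lebesgue (ball (0 :: real ^ 'n) (r / 2))"
    by (simp add: mult_ac)
qed

text \<open>\<open>\<eta>\<close> is the product of \<open>1 - bump c r\<close> over the centres \<open>c\<close> of a separated net. Since all factors
lie in \<open>[0, 1]\<close>, the integral of \<open>|\<nabla>\<eta>|\<close> is at most the number of centres times a
constant multiple of \<open>r\<^sup>d / r\<close>, and the number of centres times \<open>r\<^sup>d\<close> is bounded by the volume
of the neighbourhood of \<open>S\<close>.\<close>

lemma small_set_cutoff:
  fixes S :: "(real ^ 'n) set"
  assumes "bounded S" "r > 0"
  obtains \<eta> W where "C1_on UNIV \<eta>" "\<And>x. 0 \<le> \<eta> x \<and> \<eta> x \<le> 1"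
    and "open W" "S \<subseteq> W" "\<And>x. x \<in> W \<Longrightarrow> \<eta> x = 0"
    and "\<And>x. (\<And>c. c \<in> S \<Longrightarrow> 2 * r \<le> dist c x) \<Longrightarrow> \<eta> x = 1"
    and "integrable lebesgue (\<lambda>x. norm (gradient \<eta> x))"
    and "(LINT x|lebesgue. norm (gradient \<eta> x))
      \<le> 3 * 4 ^ CARD('n) * (measure lebesgue (\<Union>x\<in>S. ball x (r / 2)) / (r / 2))"
proof -
  obtain T where T: "finite T" "T \<subseteq> S" "S \<subseteq> (\<Union>c\<in>T. ball c r)"
    and card: "real (card T) * measure lebesgue (ball (0 :: real ^ 'n) (r / 2))
      \<le> measure lebesgue (\<Union>x\<in>S. ball x (r / 2))"
    using separated_net[OF assms] .
  let ?u = "\<lambda>c x. 1 - bump c r x"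
  define \<eta> where "\<eta> = (\<lambda>x. \<Prod>c\<in>T. ?u c x)"
  have C1u: "C1_on UNIV (?u c)" for c
    by (intro C1_on_diff C1_on_const C1_on_bump assms)
  have u01: "0 \<le> ?u c x \<and> ?u c x \<le> 1" for c x
    using bump_bounds[of c r x] by simp
  have gu: "norm (gradient (?u c) x) = norm (gradient (bump c r) x)" for c x
    using gradient_diff[OF C1_on_const C1_on_bump[OF assms(2)], of x UNIV 1 c]
      gradient_eq[OF GDERIV_const, of "1::real" x] by simp
  have C1: "C1_on UNIV \<eta>"
    unfolding \<eta>_def by (intro C1_on_prod C1u)
  have ng: "norm (gradient \<eta> x) \<le> (\<Sum>c\<in>T. norm (gradient (bump c r) x))" for x
    using norm_gradient_prod_le[OF T(1) C1u u01, where x = x] by (simp add: \<eta>_def gu)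
  let ?K = "\<Union>c\<in>T. cball c (2 * r)"
  have int: "integrable lebesgue (\<lambda>x. norm (gradient \<eta> x))"
  proof (rule integrable_continuous_compact_support[of ?K])
    show "compact ?K"
      using T(1) by (intro compact_UN) auto
    show "continuous_on ?K (\<lambda>x. norm (gradient \<eta> x))"
      by (intro continuous_intros continuous_on_subset[OF C1_on_continuous_gradient[OF C1]]) auto
    fix x assume "x \<notin> ?K"
    then have "(\<Sum>c\<in>T. norm (gradient (bump c r) x)) = 0"
      using assms(2) by (intro sum.neutral ballI) (auto intro!: gradient_bump_eq_0)
    then show "norm (gradient \<eta> x) = 0"
      using ng[of x] by simp
  qed
  show thesis
  proof (rule that[OF C1])
    show "0 \<le> \<eta> x \<and> \<eta> x \<le> 1" for x
      unfolding \<eta>_def by (rule prod_unit_interval) (rule u01)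
    show "open (\<Union>c\<in>T. ball c r)" "S \<subseteq> (\<Union>c\<in>T. ball c r)"
      using T(3) by auto
    show "\<eta> x = 0" if x: "x \<in> (\<Union>c\<in>T. ball c r)" for x
    proof -
      obtain c where "c \<in> T" "dist c x < r"
        using x by auto
      then show ?thesis
        unfolding \<eta>_def using T(1) bump_eq_1[OF assms(2), of c x] by (intro prod_zero) auto
    qed
    show "\<eta> x = 1" if "\<And>c. c \<in> S \<Longrightarrow> 2 * r \<le> dist c x" for x
      unfolding \<eta>_def using that T(2) bump_eq_0[OF assms(2)] by (intro prod.neutral) auto
    have "(LINT x|lebesgue. norm (gradient \<eta> x)) \<le> (LINT x|lebesgue. (\<Sum>c\<in>T. norm (gradient (bump c r) x)))"
      by (rule integral_mono[OF int _ ng])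
         (auto intro!: Bochner_Integration.integrable_sum integral_norm_gradient_bump_le(1) assms)
    also have "\<dots> = (\<Sum>c\<in>T. (LINT x|lebesgue. norm (gradient (bump c r) x)))"
      by (intro Bochner_Integration.integral_sum integral_norm_gradient_bump_le(1) assms)
    also have "\<dots> \<le> (\<Sum>c\<in>T. 3 * 4 ^ CARD('n) / (r / 2) * measure lebesgue (ball (0 :: real ^ 'n) (r / 2)))"
      by (intro sum_mono integral_norm_gradient_bump_le(2) assms)
    also have "\<dots> = 3 * 4 ^ CARD('n) / (r / 2) * (real (card T) * measure lebesgue (ball (0 :: real ^ 'n) (r / 2)))"
      by (simp only: sum_constant mult_ac)
    also have "\<dots> \<le> 3 * 4 ^ CARD('n) / (r / 2) * measure lebesgue (\<Union>x\<in>S. ball x (r / 2))"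
      using card assms(2) by (intro mult_left_mono) auto
    finally show "(LINT x|lebesgue. norm (gradient \<eta> x))
      \<le> 3 * 4 ^ CARD('n) * (measure lebesgue (\<Union>x\<in>S. ball x (r / 2)) / (r / 2))"
      by (simp only: times_divide_eq_left times_divide_eq_right)
  qed (rule int)
qed

section \<open>The divergence theorem for tangential fields\<close>

text \<open>For a cutoff \<open>\<eta>\<close> that vanishes near the singular boundary, \<open>\<integral> \<eta> div X = - \<integral> \<nabla>\<eta> \<bullet> X\<close>. With the
cutoffs at scale \<open>r\<close> the right-hand side is at most \<open>sup |X|\<close> times a constant times the
Minkowski quotient at \<open>r/2\<close>, and the left-hand side tends to \<open>\<integral> div X\<close>.\<close>

lemma (in tangential_field) integral_divergence_eq_0:
  assumes small: "((\<lambda>r. measure lebesgue (\<Union>x\<in>singular_boundary \<Omega>. ball x r) / r) \<longlongrightarrow> 0) (at_right 0)"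
  shows "(LINT x:\<Omega>|lebesgue. divergence X x) = 0"
proof -
  let ?S = "singular_boundary \<Omega>"
  let ?m = "\<lambda>r. measure lebesgue (\<Union>x\<in>?S. ball x r) / r"
  define r :: "nat \<Rightarrow> real" where "r = (\<lambda>n. 2 * inverse (real (Suc n)))"
  have r: "r n > 0" for n
    by (simp add: r_def)
  have r0: "r \<longlonglongrightarrow> 0"
    using tendsto_mult[OF tendsto_const[of 2] LIMSEQ_inverse_real_of_nat] by (simp add: r_def)
  then have "(\<lambda>n. r n / 2) \<longlonglongrightarrow> 0"
    by (auto intro: tendsto_divide_zero)
  then have "filterlim (\<lambda>n. r n / 2) (at_right 0) sequentially"
    using r by (auto simp: filterlim_at order_less_imp_not_eq2)
  then have m0: "(\<lambda>n. ?m (r n / 2)) \<longlonglongrightarrow> 0"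
    using filterlim_compose[OF small] by blast
  have S: "?S \<subseteq> frontier \<Omega>"
    by (auto simp: singular_boundary_def)
  have "bounded (frontier \<Omega>)"
    using bounded_closure[OF bounded_domain] by (rule bounded_subset) (auto simp: frontier_def)
  then have bS: "bounded ?S"
    using S bounded_subset by blast
  let ?K = "3 * 4 ^ CARD('n) :: real"
  have "\<exists>\<eta>. C1_on UNIV \<eta> \<and> (\<forall>x. 0 \<le> \<eta> x \<and> \<eta> x \<le> 1) \<and> flux \<eta> = 0 \<and>
      (\<forall>x. (\<forall>c\<in>?S. 2 * r n \<le> dist c x) \<longrightarrow> \<eta> x = 1) \<and>
      integrable lebesgue (\<lambda>x. norm (gradient \<eta> x)) \<and>
      (LINT x|lebesgue. norm (gradient \<eta> x)) \<le> ?K * ?m (r n / 2)" for n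
    by (rule small_set_cutoff[OF bS r[of n]])
       (intro exI conjI allI impI, auto intro: flux_eq_0_off_singular_boundary)
  then obtain \<eta> where \<eta>: "\<And>n. C1_on UNIV (\<eta> n)" "\<And>n x. 0 \<le> \<eta> n x \<and> \<eta> n x \<le> 1"
      "\<And>n. flux (\<eta> n) = 0" "\<And>n x. (\<And>c. c \<in> ?S \<Longrightarrow> 2 * r n \<le> dist c x) \<Longrightarrow> \<eta> n x = 1"
      "\<And>n. integrable lebesgue (\<lambda>x. norm (gradient (\<eta> n) x))"
      "\<And>n. (LINT x|lebesgue. norm (gradient (\<eta> n) x)) \<le> ?K * ?m (r n / 2)"
    by metis
  let ?I = "\<lambda>n. LINT x:\<Omega>|lebesgue. \<eta> n x * divergence X x"
  obtain C where C: "C \<ge> 0" "\<And>x. x \<in> closure \<Omega> \<Longrightarrow> norm (X x) \<le> C"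
    using bounded_field by blast
  have le: "\<bar>?I n\<bar> \<le> C * (?K * ?m (r n / 2))" for n
  proof -
    have "?I n = - (LINT x:\<Omega>|lebesgue. gradient (\<eta> n) x \<bullet> X x)"
      using flux_eq[OF \<eta>(1), of n] \<eta>(3)[of n] by simp
    then have "\<bar>?I n\<bar> = \<bar>LINT x:\<Omega>|lebesgue. gradient (\<eta> n) x \<bullet> X x\<bar>"
      by simp
    also have "\<dots> \<le> (LINT x|lebesgue. C * norm (gradient (\<eta> n) x))"
    proof (rule abs_set_integral_le_integral[OF integrable_gradient_inner[OF \<eta>(1)]])
      fix x assume "x \<in> \<Omega>"
      then have "norm (X x) \<le> C"
        using C(2) closure_subset by blast
      then have "norm (gradient (\<eta> n) x) * norm (X x) \<le> norm (gradient (\<eta> n) x) * C"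
        by (intro mult_left_mono) auto
      then show "\<bar>gradient (\<eta> n) x \<bullet> X x\<bar> \<le> C * norm (gradient (\<eta> n) x)"
        using Cauchy_Schwarz_ineq2[of "gradient (\<eta> n) x" "X x"] by (simp add: mult.commute)
    qed (use \<eta>(5) C(1) in auto)
    also have "\<dots> \<le> C * (?K * ?m (r n / 2))"
      using mult_left_mono[OF \<eta>(6)[of n] C(1)] by simp
    finally show ?thesis .
  qed
  have "(\<lambda>n. C * (?K * ?m (r n / 2))) \<longlonglongrightarrow> 0"
    by (intro tendsto_mult_right_zero m0)
  then have "?I \<longlonglongrightarrow> 0"
    by (rule Lim_null_comparison[rotated])
       (rule always_eventually, rule allI, simp only: real_norm_def, rule le)
  moreover have "?I \<longlonglongrightarrow> (LINT x:\<Omega>|lebesgue. divergence X x)"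
    unfolding set_lebesgue_integral_def
  proof (rule integral_dominated_convergence
      [where w = "\<lambda>y. norm (indicator \<Omega> y *\<^sub>R divergence X y)"])
    show "integrable lebesgue (\<lambda>y. norm (indicator \<Omega> y *\<^sub>R divergence X y))"
      using integrable_divergence unfolding set_integrable_def by (rule integrable_norm)
    show "(\<lambda>y. indicator \<Omega> y *\<^sub>R divergence X y) \<in> borel_measurable lebesgue"
      using integrable_divergence unfolding set_integrable_def by (rule borel_measurable_integrable)
    show "(\<lambda>y. indicator \<Omega> y *\<^sub>R (\<eta> n y * divergence X y)) \<in> borel_measurable lebesgue" for n
      using integrable_mult_divergence[OF \<eta>(1)] unfolding set_integrable_def
      by (rule borel_measurable_integrable)
    have "norm (\<eta> n y * divergence X y) \<le> norm (divergence X y)" for n y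
      using mult_right_mono[of "\<bar>\<eta> n y\<bar>" 1 "\<bar>divergence X y\<bar>"] \<eta>(2)[of n y]
      by (simp add: abs_mult)
    then show "AE y in lebesgue. norm (indicator \<Omega> y *\<^sub>R (\<eta> n y * divergence X y))
        \<le> norm (indicator \<Omega> y *\<^sub>R divergence X y)" for n
      by (intro always_eventually allI) (simp add: indicator_def)
    have "(\<lambda>n. \<eta> n y * divergence X y) \<longlonglongrightarrow> divergence X y" if y: "y \<in> \<Omega>" for y
    proof -
      obtain e where e: "e > 0" "ball y e \<subseteq> \<Omega>"
        using open_domain y open_contains_ball by blast
      \<comment> \<open>Each point of the domain has positive distance from the singular boundary.\<close>
      have far: "e \<le> dist c y" if "c \<in> ?S" for c
      proof -
        have "c \<notin> \<Omega>"
          using that S open_domain by (auto simp: frontier_def interior_open)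
        then show ?thesis
          using e(2) by (force simp: dist_commute not_less[symmetric])
      qed
      have "\<forall>\<^sub>F n in sequentially. r n < e / 2"
        using order_tendstoD(2)[OF r0, of "e / 2"] e(1) by simp
      then have "\<forall>\<^sub>F n in sequentially. \<eta> n y * divergence X y = divergence X y"
      proof eventually_elim
        case (elim n)
        then have "\<eta> n y = 1"
          using far by (intro \<eta>(4)) force
        then show ?case by simp
      qed
      then show ?thesis
        by (rule tendsto_eventually)
    qed
    then show "AE y in lebesgue. (\<lambda>n. indicator \<Omega> y *\<^sub>R (\<eta> n y * divergence X y))
        \<longlonglongrightarrow> indicator \<Omega> y *\<^sub>R divergence X y"
      by (intro always_eventually allI) (auto simp: indicator_def)
  qed
  ultimately show ?thesis
    using LIMSEQ_unique by blast
qed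

text \<open>The inward segment from \<open>x\<close> stays in \<open>S\<close> near \<open>x\<close>, because \<open>\<rho>\<close> decreases along it. By the mean
value theorem the difference quotients of \<open>u\<close> at \<open>x\<close> are values of \<open>g \<bullet> \<nu>\<close> at points of this
segment that tend to \<open>x\<close>.\<close>

lemma normal_component_eq_normal_derivative:
  assumes S: "open S" and u: "C1_on S u" "continuous_on (closure S) u"
    and g: "continuous_on (closure S) g" "\<And>x. x \<in> S \<Longrightarrow> g x = gradient u x"
    and \<nu>: "outer_normal S x \<nu>" and der: "has_normal_derivative u x \<nu> c"
  shows "g x \<bullet> \<nu> = c"
proof -
  obtain V \<rho> where \<rho>: "open V" "x \<in> V" "C1_on V \<rho>" "gradient \<rho> x \<noteq> 0"
      "S \<inter> V = {y \<in> V. \<rho> y < 0}" "\<nu> = gradient \<rho> x /\<^sub>R norm (gradient \<rho> x)"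
    and x: "x \<in> frontier S"
    using \<nu> unfolding outer_normal_def by blast
  have xc: "x \<in> closure S" and xS: "x \<notin> S"
    using x S by (auto simp: frontier_def interior_open)
  \<comment> \<open>The boundary point \<open>x\<close> is a limit of points with \<open>\<rho> < 0\<close> and not itself one, so \<open>\<rho> x = 0\<close>.\<close>
  have "\<not> 0 < \<rho> x"
  proof
    assume "0 < \<rho> x"
    have "open (V \<inter> \<rho> -` {0<..})"
      by (intro continuous_open_preimage C1_on_continuous \<rho>(1,3)) auto
    moreover have "x \<in> V \<inter> \<rho> -` {0<..}"
      using \<rho>(2) \<open>0 < \<rho> x\<close> by simp
    ultimately have "S \<inter> (V \<inter> \<rho> -` {0<..}) \<noteq> {}"
      using xc open_Int_closure_eq_empty[of "V \<inter> \<rho> -` {0<..}" S] by blast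
    then show False
      using \<rho>(5) by force
  qed
  then have \<rho>x: "\<rho> x = 0"
    using xS \<rho>(2,5) by force
  have line: "((\<lambda>t. x - t *\<^sub>R \<nu>) has_derivative (\<lambda>h. - (h *\<^sub>R \<nu>))) (at t)" for t
    by (auto intro!: derivative_eq_intros)
  have chain: "DERIV (\<lambda>t. f (x - t *\<^sub>R \<nu>)) t :> - (gradient f (x - t *\<^sub>R \<nu>) \<bullet> \<nu>)"
    if "C1_on T f" "x - t *\<^sub>R \<nu> \<in> T" for f T t
  proof -
    have "((\<lambda>t. f (x - t *\<^sub>R \<nu>)) has_derivative (\<lambda>h. - (h *\<^sub>R \<nu>) \<bullet> gradient f (x - t *\<^sub>R \<nu>))) (at t)"
      by (rule has_derivative_compose[OF line])
         (use C1_on_GDERIV[OF that] in \<open>simp add: gderiv_def\<close>)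
    moreover have "(\<lambda>h. - (h *\<^sub>R \<nu>) \<bullet> gradient f (x - t *\<^sub>R \<nu>)) = (*) (- (gradient f (x - t *\<^sub>R \<nu>) \<bullet> \<nu>))"
      by (auto simp: inner_commute)
    ultimately show ?thesis
      by (simp only: has_field_derivative_def)
  qed
  have D: "DERIV (\<lambda>t. \<rho> (x - t *\<^sub>R \<nu>)) 0 :> - (gradient \<rho> (x - 0 *\<^sub>R \<nu>) \<bullet> \<nu>)"
    by (rule chain[OF \<rho>(3)]) (use \<rho>(2) in simp)
  have "gradient \<rho> x \<bullet> \<nu> > 0"
    using \<rho>(4) by (simp add: \<rho>(6) dot_square_norm power2_eq_square)
  then have "- (gradient \<rho> (x - 0 *\<^sub>R \<nu>) \<bullet> \<nu>) < 0"
    by simp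
  from DERIV_neg_dec_right[OF D this]
  have "\<exists>d>0. \<forall>h>0. h < d \<longrightarrow> \<rho> (x - (0 + h) *\<^sub>R \<nu>) < \<rho> (x - 0 *\<^sub>R \<nu>)"
    .
  then obtain d1 where d1: "d1 > 0" "\<And>t. 0 < t \<Longrightarrow> t < d1 \<Longrightarrow> \<rho> (x - t *\<^sub>R \<nu>) < 0"
    using \<rho>x by auto
  have "\<forall>\<^sub>F t in at 0. x - t *\<^sub>R \<nu> \<in> V"
  proof (rule topological_tendstoD[OF _ \<rho>(1)])
    show "((\<lambda>t. x - t *\<^sub>R \<nu>) \<longlongrightarrow> x) (at 0)"
      by (auto intro!: tendsto_eq_intros)
  qed (rule \<rho>(2))
  then obtain d2 where d2: "d2 > 0" "\<And>t. t \<noteq> 0 \<Longrightarrow> dist t 0 < d2 \<Longrightarrow> x - t *\<^sub>R \<nu> \<in> V"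
    unfolding eventually_at by auto
  define d where "d = min d1 d2"
  have d: "d > 0"
    using d1(1) d2(1) by (simp add: d_def)
  have inS: "x - t *\<^sub>R \<nu> \<in> S" if "0 < t" "t < d" for t
    using d1(2)[of t] d2(2)[of t] that \<rho>(5) by (auto simp: d_def)
  have inC: "x - t *\<^sub>R \<nu> \<in> closure S" if "0 \<le> t" "t < d" for t
    using inS[of t] that xc closure_subset[of S] by (cases "t = 0") auto
  let ?q = "\<lambda>t. (u x - u (x - t *\<^sub>R \<nu>)) / t" and ?h = "\<lambda>t. g (x - t *\<^sub>R \<nu>) \<bullet> \<nu>"
  have "\<exists>s. 0 < s \<and> s < t \<and> ?q t = ?h s" if t: "0 < t" "t < d" for t
  proof -
    let ?f = "\<lambda>t. u (x - t *\<^sub>R \<nu>)"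
    have "continuous_on {0..t} ?f"
      by (rule continuous_on_compose2[OF u(2)])
         (use inC t in \<open>auto intro!: continuous_intros\<close>)
    moreover have "DERIV ?f s :> - ?h s" if "0 < s" "s < t" for s
      using chain[OF u(1) inS[of s]] g(2)[OF inS[of s]] that t by auto
    ultimately obtain l s where s: "0 < s" "s < t" "DERIV ?f s :> l" "?f t - ?f 0 = (t - 0) * l"
      using MVT[of 0 t ?f] t(1) by (metis (no_types, lifting) real_differentiable_def)
    moreover have "l = - ?h s"
      using DERIV_unique[OF s(3)] \<open>\<And>s. 0 < s \<Longrightarrow> s < t \<Longrightarrow> DERIV ?f s :> - ?h s\<close> s(1,2) by blast
    ultimately have "?q t = ?h s"
      using t(1) by (simp add: field_simps)
    with s show ?thesis by blast
  qed
  then obtain s where s: "\<And>t. 0 < t \<Longrightarrow> t < d \<Longrightarrow> 0 < s t \<and> s t < t \<and> ?q t = ?h (s t)"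
    by metis
  have ev: "\<forall>\<^sub>F t in at_right 0. 0 < t \<and> t < d"
    using eventually_at_right_less[of "0::real"] d
    by (auto simp: eventually_at_right_field intro!: exI[of _ d])
  have "((\<lambda>t::real. t) \<longlongrightarrow> 0) (at_right 0)"
    by (rule tendsto_ident_at)
  moreover have "\<forall>\<^sub>F t in at_right 0. 0 \<le> s t" "\<forall>\<^sub>F t in at_right 0. s t \<le> t"
    "\<forall>\<^sub>F t in at_right 0. s t \<in> {0<..<d} \<and> s t \<noteq> 0"
    using ev by (eventually_elim, use s in force)+
  ultimately have "filterlim s (at 0 within {0<..<d}) (at_right 0)"
    unfolding filterlim_at by (auto intro: tendsto_sandwich[OF _ _ tendsto_const])
  moreover have "continuous_on {0..<d} ?h"
    by (intro continuous_intros continuous_on_compose2[OF g(1)]) (use inC in auto)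
  then have "(?h \<longlongrightarrow> ?h 0) (at 0 within {0..<d})"
    unfolding continuous_on_def using d by (elim bspec) simp
  then have "(?h \<longlongrightarrow> ?h 0) (at 0 within {0<..<d})"
    by (rule tendsto_within_subset) auto
  ultimately have "((\<lambda>t. ?h (s t)) \<longlongrightarrow> ?h 0) (at_right 0)"
    by (rule filterlim_compose[rotated])
  then have "(?q \<longlongrightarrow> ?h 0) (at_right 0)"
    by (rule Lim_transform_eventually) (use ev in eventually_elim, use s in auto)
  then have "?h 0 = c"
    using der unfolding has_normal_derivative_def
    by (intro tendsto_unique[OF trivial_limit_at_right_real])
  then show ?thesis by simp
qed

section \<open>Green identities\<close>

lemma divergence_gradient: "divergence (gradient u) x = laplacian u x"
  by (simp add: divergence_def laplacian_def)

lemma C1_on_cong_open: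
  fixes u v :: "real ^ 'n \<Rightarrow> real"
  assumes "open S" "C1_on S u" "\<And>x. x \<in> S \<Longrightarrow> u x = v x"
  shows "C1_on S v"
proof (rule C1_onI[OF C1_on_continuous_gradient[OF assms(2)]])
  show "GDERIV v x :> gradient u x" if "x \<in> S" for x
    by (rule GDERIV_transform_open[OF C1_on_GDERIV[OF assms(2) that] assms(1) that assms(3)])
qed

lemma gradient_cong_open:
  fixes u v :: "real ^ 'n \<Rightarrow> real"
  assumes "open S" "C1_on S u" "\<And>x. x \<in> S \<Longrightarrow> u x = v x" "x \<in> S"
  shows "gradient v x = gradient u x"
  by (rule gradient_eq, rule GDERIV_transform_open[OF C1_on_GDERIV[OF assms(2,4)] assms(1,4,3)])

lemma C1_closure_diff:
  assumes "C1_closure S u" "C1_closure S v"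
  shows "C1_closure S (\<lambda>x. u x - v x)"
proof -
  have C1: "C1_on S u" "C1_on S v" and cont: "continuous_on (closure S) u" "continuous_on (closure S) v"
    using assms by (auto simp: C1_closure_def)
  obtain g where g: "continuous_on (closure S) g" "\<forall>x\<in>S. g x = gradient u x"
    using assms(1) by (auto simp: C1_closure_def)
  obtain h where h: "continuous_on (closure S) h" "\<forall>x\<in>S. h x = gradient v x"
    using assms(2) by (auto simp: C1_closure_def)
  have "continuous_on (closure S) (\<lambda>x. g x - h x)"
    using g(1) h(1) by (intro continuous_intros)
  moreover have "\<forall>x\<in>S. g x - h x = gradient (\<lambda>x. u x - v x) x"
    using g(2) h(2) gradient_diff[OF C1] by simp
  ultimately have "\<exists>k. continuous_on (closure S) k \<and> (\<forall>x\<in>S. k x = gradient (\<lambda>x. u x - v x) x)"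
    by (intro exI[of _ "\<lambda>x. g x - h x"] conjI)
  then show ?thesis
    unfolding C1_closure_def using C1_on_diff[OF C1] continuous_on_diff[OF cont] by blast
qed

lemma C1_closure_bounded:
  fixes S :: "(real ^ 'n) set"
  assumes "bounded S" "C1_closure S u"
  shows "\<exists>C. \<forall>x\<in>S. \<bar>u x\<bar> \<le> C \<and> norm (gradient u x) \<le> C"
proof -
  obtain g where g: "continuous_on (closure S) g" "\<forall>x\<in>S. g x = gradient u x"
    and u: "continuous_on (closure S) u"
    using assms(2) by (auto simp: C1_closure_def)
  have "compact (closure S)"
    using assms(1) by (simp add: compact_closure)
  then have "bounded (u ` closure S)" "bounded (g ` closure S)"
    using u g(1) by (auto intro!: compact_imp_bounded compact_continuous_image)
  then obtain A B where "\<forall>x\<in>closure S. \<bar>u x\<bar> \<le> A" "\<forall>x\<in>closure S. norm (g x) \<le> B"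
    by (auto simp: bounded_iff)
  then have "\<forall>x\<in>S. \<bar>u x\<bar> \<le> max A B \<and> norm (gradient u x) \<le> max A B"
    using g(2) closure_subset[of S] by (force simp: le_max_iff_disj)
  then show ?thesis ..
qed

lemma integrable_gradient_product:
  fixes S :: "(real ^ 'n) set"
  assumes S: "open S" "bounded S" and C1: "C1_on S u" "C1_on S v"
    and bd: "\<exists>C. \<forall>x\<in>S. norm (gradient u x) \<le> C" "\<exists>C. \<forall>x\<in>S. norm (gradient v x) \<le> C"
  shows "set_integrable lebesgue S (\<lambda>x. gradient u x \<bullet> gradient v x)"
proof -
  obtain A where A: "\<forall>x\<in>S. norm (gradient u x) \<le> A" using bd(1) by blast
  obtain B where B: "\<forall>x\<in>S. norm (gradient v x) \<le> B" using bd(2) by blast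
  show ?thesis
  proof (rule set_integrable_bounded_continuous[OF S, where C = "A * B"])
    show "continuous_on S (\<lambda>x. gradient u x \<bullet> gradient v x)"
      using C1 by (intro continuous_intros C1_on_continuous_gradient)
    fix x assume x: "x \<in> S"
    have "\<bar>gradient u x \<bullet> gradient v x\<bar> \<le> norm (gradient u x) * norm (gradient v x)"
      by (rule Cauchy_Schwarz_ineq2)
    also have "\<dots> \<le> A * B"
      using A B x order_trans[OF norm_ge_zero, of "gradient u x" A] by (intro mult_mono) auto
    finally show "\<bar>gradient u x \<bullet> gradient v x\<bar> \<le> A * B" .
  qed
qed

text \<open>The divergence theorem for \<open>v g\<close>, where \<open>g\<close> is the continuous extension of \<open>\<nabla>u\<close> to the closed
domain: the Neumann condition makes this field tangential.\<close>

lemma green_identity_neumann: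
  fixes \<Omega> :: "(real ^ 'n) set"
  assumes \<Omega>: "piecewise_C1_domain \<Omega>"
    and u: "C2_on \<Omega> u" "C1_closure \<Omega> u" "homogeneous_neumann \<Omega> u"
    and v: "C1_closure \<Omega> v"
    and int: "set_integrable lebesgue \<Omega> (\<lambda>x. v x * laplacian u x)"
  shows "(LINT x:\<Omega>|lebesgue. v x * laplacian u x) = - (LINT x:\<Omega>|lebesgue. gradient v x \<bullet> gradient u x)"
proof -
  have op: "open \<Omega>" and bd: "bounded \<Omega>"
    and small: "((\<lambda>r. measure lebesgue (\<Union>x\<in>singular_boundary \<Omega>. ball x r) / r) \<longlongrightarrow> 0) (at_right 0)"
    using \<Omega> by (auto simp: piecewise_C1_domain_def)
  obtain g where g: "continuous_on (closure \<Omega>) g" "\<And>x. x \<in> \<Omega> \<Longrightarrow> g x = gradient u x"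
    using u(2) by (auto simp: C1_closure_def)
  have C1: "C1_on \<Omega> u" "C1_on \<Omega> v" and cont: "continuous_on (closure \<Omega>) u" "continuous_on (closure \<Omega>) v"
    using u(2) v by (auto simp: C1_closure_def)
  have C1g: "C1_on \<Omega> (\<lambda>x. gradient u x $ i)" for i
    using u(1) by (simp add: C2_on_def)
  let ?X = "\<lambda>x. v x *\<^sub>R g x"
  have eq: "v x *\<^sub>R gradient u x $ i = ?X x $ i" if "x \<in> \<Omega>" for x i
    using g(2)[OF that] by simp
  have C1p: "C1_on \<Omega> (\<lambda>x. v x *\<^sub>R gradient u x $ i)" for i
    using C1_on_mult[OF C1(2) C1g] by simp
  have div: "divergence ?X x = v x * laplacian u x + gradient v x \<bullet> gradient u x" if x: "x \<in> \<Omega>" for x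
  proof -
    have "divergence ?X x = divergence (\<lambda>x. v x *\<^sub>R gradient u x) x"
      unfolding divergence_def
      using gradient_cong_open[OF op C1p eq x] by simp
    also have "\<dots> = v x * laplacian u x + gradient v x \<bullet> gradient u x"
      by (simp only: divergence_scaleR[OF C1(2) C1g x] divergence_gradient)
    finally show ?thesis .
  qed
  have int2: "set_integrable lebesgue \<Omega> (\<lambda>x. gradient v x \<bullet> gradient u x)"
    using C1_closure_bounded[OF bd v] C1_closure_bounded[OF bd u(2)]
    by (intro integrable_gradient_product op bd C1) blast+
  interpret tangential_field \<Omega> ?X
  proof
    show "C1_on \<Omega> (\<lambda>x. ?X x $ i)" for i
      by (rule C1_on_cong_open[OF op C1p eq])
    show "continuous_on (closure \<Omega>) ?X"
      by (intro continuous_intros cont g)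
    show "?X x \<bullet> \<nu> = 0" if "outer_normal \<Omega> x \<nu>" for x \<nu>
      using normal_component_eq_normal_derivative[OF op C1(1) cont(1) g that] u(3) that
      by (auto simp: homogeneous_neumann_def)
    show "set_integrable lebesgue \<Omega> (divergence ?X)"
      using set_integral_add(1)[OF int int2]
      by (rule iffD2[OF set_integrable_cong[OF refl refl div], rotated])
  qed (rule op bd)+
  have "(LINT x:\<Omega>|lebesgue. v x * laplacian u x + gradient v x \<bullet> gradient u x)
      = (LINT x:\<Omega>|lebesgue. divergence ?X x)"
    using op div by (intro set_lebesgue_integral_cong) auto
  then show ?thesis
    using integral_divergence_eq_0[OF small] int int2 by simp
qed

lemma gradient_cell_periodic:
  assumes "C1_on UNIV u" "cell_periodic p u"
  shows "cell_periodic p (\<lambda>x. gradient u x $ i)"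
proof -
  have "gradient u (x + axis j (p $ j)) = gradient u x" for x j
  proof -
    let ?s = "axis j (p $ j)"
    have "((\<lambda>y. u (y + ?s)) has_derivative (\<lambda>h. h \<bullet> gradient u (x + ?s))) (at x)"
    proof (rule has_derivative_compose[where f = "\<lambda>y. y + ?s"])
      show "((\<lambda>y. y + ?s) has_derivative (\<lambda>h. h)) (at x)"
        by (auto intro!: derivative_eq_intros)
      show "(u has_derivative (\<lambda>h. h \<bullet> gradient u (x + ?s))) (at (x + ?s))"
        using C1_on_GDERIV[OF assms(1)] by (simp add: gderiv_def)
    qed
    moreover have "(\<lambda>y. u (y + ?s)) = u"
      using assms(2) by (auto simp: cell_periodic_def)
    ultimately have "GDERIV u x :> gradient u (x + ?s)"
      by (simp add: gderiv_def)
    then show ?thesis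
      using gradient_eq by metis
  qed
  then show ?thesis
    by (simp add: cell_periodic_def)
qed

lemma green_identity_periodic:
  fixes a b :: "real ^ 'n"
  assumes ab: "\<And>i. a $ i < b $ i"
    and u: "C2_on UNIV u" "cell_periodic (b - a) u" and v: "C1_on UNIV v" "cell_periodic (b - a) v"
  shows "(LINT x:box a b|lebesgue. v x * laplacian u x)
    = - (LINT x:box a b|lebesgue. gradient v x \<bullet> gradient u x)"
proof -
  let ?X = "\<lambda>x. v x *\<^sub>R gradient u x"
  have C1u: "C1_on UNIV u" and C1g: "\<And>i. C1_on UNIV (\<lambda>x. gradient u x $ i)"
    using u(1) by (auto simp: C2_on_def)
  have C1X: "C1_on UNIV (\<lambda>x. ?X x $ i)" for i
    using C1_on_mult[OF v(1) C1g] by simp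
  have perX: "cell_periodic (b - a) (\<lambda>x. ?X x $ i)" for i
    using gradient_cell_periodic[OF C1u u(2), of i] v(2) by (simp add: cell_periodic_def)
  have int: "(\<lambda>x. gradient (\<lambda>x. ?X x $ i) x $ i) integrable_on cbox a b" for i
    by (intro integrable_continuous continuous_intros
        continuous_on_subset[OF C1_on_continuous_gradient[OF C1X]]) auto
  have div: "divergence ?X x = v x * laplacian u x + gradient v x \<bullet> gradient u x" for x
    by (simp only: divergence_scaleR[OF v(1) C1g UNIV_I] divergence_gradient)
  have zero: "integral (cbox a b) (divergence ?X) = 0"
  proof -
    have "integral (cbox a b) (divergence ?X)
        = (\<Sum>i\<in>UNIV. integral (cbox a b) (\<lambda>x. gradient (\<lambda>x. ?X x $ i) x $ i))"
      unfolding divergence_def[abs_def]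
      by (intro Henstock_Kurzweil_Integration.integral_sum finite int)
    also have "\<dots> = 0"
      by (intro sum.neutral ballI integral_partial_periodic[OF C1X ab perX])
    finally show ?thesis .
  qed
  have contv: "continuous_on S v" and contgv: "continuous_on S (gradient v)"
    and contgu: "continuous_on S (gradient u)" for S
    using C1_on_continuous[OF v(1)] C1_on_continuous_gradient[OF v(1)]
      C1_on_continuous_gradient[OF C1u] continuous_on_subset by blast+
  have contl: "continuous_on S (laplacian u)" for S
    unfolding laplacian_def
    by (intro continuous_intros continuous_on_subset[OF C1_on_continuous_gradient[OF C1g]]) auto
  have ai: "set_integrable lebesgue (box a b) f" if "continuous_on (cbox a b) f" for f :: "real ^ 'n \<Rightarrow> real"
    by (rule set_integrable_subset[OF absolutely_integrable_continuous[OF that]])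
       (auto simp: box_subset_cbox)
  have i1: "set_integrable lebesgue (box a b) (\<lambda>x. v x * laplacian u x)"
    by (intro ai continuous_intros contv contl)
  have i2: "set_integrable lebesgue (box a b) (\<lambda>x. gradient v x \<bullet> gradient u x)"
    by (intro ai continuous_intros contgv contgu)
  have "(LINT x:box a b|lebesgue. v x * laplacian u x + gradient v x \<bullet> gradient u x)
      = integral (box a b) (\<lambda>x. v x * laplacian u x + gradient v x \<bullet> gradient u x)"
    by (rule set_lebesgue_integral_eq_integral(2)[OF set_integral_add(1)[OF i1 i2]])
  also have "\<dots> = integral (cbox a b) (divergence ?X)"
    by (simp only: integral_open_interval ext[of "divergence ?X", OF div])
  finally show ?thesis
    using i1 i2 zero by simp
qed

section \<open>The energy estimate\<close>

lemma L2_mult_integrable: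
  assumes "L2 S u" "L2 S v"
  shows "set_integrable lebesgue S (\<lambda>x. u x * v x)"
proof (rule set_integrable_bound[where f = "\<lambda>x. (u x)\<^sup>2 + (v x)\<^sup>2"])
  show "set_integrable lebesgue S (\<lambda>x. (u x)\<^sup>2 + (v x)\<^sup>2)"
    using assms by (intro set_integral_add(1)) (auto simp: L2_def)
  show "set_borel_measurable lebesgue S (\<lambda>x. u x * v x)"
    using assms by (intro set_borel_measurable_times) (auto simp: L2_def)
  have "\<bar>p * q\<bar> \<le> p\<^sup>2 + q\<^sup>2" for p q :: real
    using sum_squares_bound[of "\<bar>p\<bar>" "\<bar>q\<bar>"] mult_nonneg_nonneg[OF abs_ge_zero[of p] abs_ge_zero[of q]]
    unfolding abs_mult power2_abs by linarith
  then show "AE x in lebesgue. x \<in> S \<longrightarrow> norm (u x * v x) \<le> norm ((u x)\<^sup>2 + (v x)\<^sup>2)"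
    by (intro always_eventually) simp
qed

text \<open>What the energy estimate needs of the boundary conditions: \<open>W\<close> holds the functions that satisfy
them with two derivatives, and \<open>V\<close> the test functions against which Green's identity holds.\<close>

locale green_boundary_conditions =
  fixes \<Omega> :: "(real ^ 'n) set" and V W :: "(real ^ 'n \<Rightarrow> real) set"
  assumes open_domain: "open \<Omega>" and bounded_domain: "bounded \<Omega>"
    and W_subset: "W \<subseteq> V"
    and V_diff: "u \<in> V \<Longrightarrow> v \<in> V \<Longrightarrow> (\<lambda>x. u x - v x) \<in> V"
    and V_C1: "v \<in> V \<Longrightarrow> C1_on \<Omega> v"
    and V_bounded: "v \<in> V \<Longrightarrow> \<exists>C. \<forall>x\<in>\<Omega>. \<bar>v x\<bar> \<le> C \<and> norm (gradient v x) \<le> C"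
    and green: "v \<in> V \<Longrightarrow> u \<in> W \<Longrightarrow> set_integrable lebesgue \<Omega> (\<lambda>x. v x * laplacian u x) \<Longrightarrow>
      (LINT x:\<Omega>|lebesgue. v x * laplacian u x) = - (LINT x:\<Omega>|lebesgue. gradient v x \<bullet> gradient u x)"
begin

lemma integrable_gradients:
  assumes "u \<in> V" "v \<in> V"
  shows "set_integrable lebesgue \<Omega> (\<lambda>x. gradient u x \<bullet> gradient v x)"
  using V_bounded[OF assms(1)] V_bounded[OF assms(2)]
  by (intro integrable_gradient_product open_domain bounded_domain V_C1 assms) blast+

lemma integrable_product:
  assumes "u \<in> V" "v \<in> V"
  shows "set_integrable lebesgue \<Omega> (\<lambda>x. u x * v x)"
proof -
  have c: "continuous_on \<Omega> u" "continuous_on \<Omega> v"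
    using V_C1 assms C1_on_continuous by auto
  obtain A where A: "\<forall>x\<in>\<Omega>. \<bar>u x\<bar> \<le> A" using V_bounded[OF assms(1)] by blast
  obtain B where B: "\<forall>x\<in>\<Omega>. \<bar>v x\<bar> \<le> B" using V_bounded[OF assms(2)] by blast
  show ?thesis
    using set_integrable_bounded_mult[OF set_borel_measurable_continuous_open[OF open_domain c(1)], of A v]
      set_integrable_bounded_continuous[OF open_domain bounded_domain c(2), of B] A B by blast
qed

text \<open>Here \<open>h\<close> stands for the coefficient \<open>H\<close> at the old time. The integrability of \<open>w \<Delta>w\<close> and of \<open>d \<Delta>\<phi>'\<close>, with \<open>d = \<phi>' - \<phi>\<close>, is read off
from these equations: the former equals \<open>w d / (\<tau> M)\<close>, and \<open>\<epsilon>\<^sup>2 d \<Delta>\<phi>'\<close> equals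
\<open>2 U' (U' - U) - w d\<close>.\<close>

theorem energy_dissipation:
  fixes \<phi> \<phi>' w U U' h :: "real ^ 'n \<Rightarrow> real"
  assumes pos: "\<epsilon> > 0" "M > 0" "\<tau> > 0"
    and reg: "\<phi> \<in> V" "\<phi>' \<in> W" "w \<in> W" "L2 \<Omega> U" "L2 \<Omega> U'"
    and e1: "\<And>x. x \<in> \<Omega> \<Longrightarrow> (\<phi>' x - \<phi> x) / \<tau> - M * laplacian w x = 0"
    and e2: "\<And>x. x \<in> \<Omega> \<Longrightarrow> w x = - (\<epsilon>\<^sup>2 * laplacian \<phi>' x) + h x * U' x"
    and e3: "\<And>x. x \<in> \<Omega> \<Longrightarrow> U' x - U x = 1 / 2 * h x * (\<phi>' x - \<phi> x)"
  shows "energy \<Omega> \<epsilon> \<phi>' U' \<le> energy \<Omega> \<epsilon> \<phi> U - \<tau> * M * (L2_norm \<Omega> (gradient w))\<^sup>2"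
proof -
  let ?d = "\<lambda>x. \<phi>' x - \<phi> x"
  have V: "\<phi>' \<in> V" "w \<in> V" "?d \<in> V"
    using reg W_subset V_diff by auto
  have \<Omega>[measurable]: "\<Omega> \<in> sets lebesgue"
    using open_domain by simp
  have grad_d: "gradient ?d x = gradient \<phi>' x - gradient \<phi> x" if "x \<in> \<Omega>" for x
    using gradient_diff V_C1 V(1) reg(1) that by blast
  have int_wd: "set_integrable lebesgue \<Omega> (\<lambda>x. w x * ?d x)"
    using integrable_product[OF V(2,3)] .
  have int_U: "set_integrable lebesgue \<Omega> (\<lambda>x. 2 * (U' x * U' x - U' x * U x))"
    using L2_mult_integrable[OF reg(5) reg(5)] L2_mult_integrable[OF reg(5) reg(4)] by simp

  have lap_w: "w x * laplacian w x = w x * ?d x / (\<tau> * M)" if "x \<in> \<Omega>" for x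
    using e1[OF that] pos by (simp add: field_simps)
  have "set_integrable lebesgue \<Omega> (\<lambda>x. w x * ?d x / (\<tau> * M))"
    using int_wd by simp
  then have "set_integrable lebesgue \<Omega> (\<lambda>x. w x * laplacian w x)"
    by (rule iffD2[OF set_integrable_cong[OF refl refl lap_w], rotated])
  from green[OF V(2) reg(3) this]
  have "(LINT x:\<Omega>|lebesgue. w x * ?d x / (\<tau> * M)) = - (LINT x:\<Omega>|lebesgue. gradient w x \<bullet> gradient w x)"
    using set_lebesgue_integral_cong[OF \<Omega>, of "\<lambda>x. w x * laplacian w x" "\<lambda>x. w x * ?d x / (\<tau> * M)"] lap_w
    by simp
  then have 1: "(LINT x:\<Omega>|lebesgue. w x * ?d x) = - (\<tau> * M * (LINT x:\<Omega>|lebesgue. gradient w x \<bullet> gradient w x))"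
    using pos by (simp add: field_simps)

  have lap_\<phi>: "?d x * laplacian \<phi>' x = (2 * (U' x * U' x - U' x * U x) - w x * ?d x) / \<epsilon>\<^sup>2"
    if "x \<in> \<Omega>" for x
  proof -
    have "2 * (U' x * U' x - U' x * U x) = 2 * U' x * (U' x - U x)"
      by (simp add: algebra_simps)
    also have "\<dots> = h x * U' x * ?d x"
      unfolding e3[OF that] by simp
    finally have "2 * (U' x * U' x - U' x * U x) - w x * ?d x = \<epsilon>\<^sup>2 * (?d x * laplacian \<phi>' x)"
      unfolding e2[OF that] by (simp add: algebra_simps)
    then show ?thesis
      using pos(1) by simp
  qed
  have int_r: "set_integrable lebesgue \<Omega> (\<lambda>x. (2 * (U' x * U' x - U' x * U x) - w x * ?d x) / \<epsilon>\<^sup>2)"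
    by (intro set_integrable_divide set_integral_diff(1) int_U int_wd)
  then have "set_integrable lebesgue \<Omega> (\<lambda>x. ?d x * laplacian \<phi>' x)"
    by (rule iffD2[OF set_integrable_cong[OF refl refl lap_\<phi>], rotated])
  from green[OF V(3) reg(2) this]
  have "(LINT x:\<Omega>|lebesgue. (2 * (U' x * U' x - U' x * U x) - w x * ?d x) / \<epsilon>\<^sup>2)
      = - (LINT x:\<Omega>|lebesgue. gradient ?d x \<bullet> gradient \<phi>' x)"
    using set_lebesgue_integral_cong[OF \<Omega>, of "\<lambda>x. ?d x * laplacian \<phi>' x"
      "\<lambda>x. (2 * (U' x * U' x - U' x * U x) - w x * ?d x) / \<epsilon>\<^sup>2"] lap_\<phi> by simp
  then have "(LINT x:\<Omega>|lebesgue. 2 * (U' x * U' x - U' x * U x) - w x * ?d x)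
      = - (\<epsilon>\<^sup>2 * (LINT x:\<Omega>|lebesgue. gradient ?d x \<bullet> gradient \<phi>' x))"
    using pos(1) by (simp only: set_integral_divide_zero) (simp add: field_simps)
  then have 2: "(LINT x:\<Omega>|lebesgue. w x * ?d x)
      = \<epsilon>\<^sup>2 * (LINT x:\<Omega>|lebesgue. gradient ?d x \<bullet> gradient \<phi>' x)
        + (LINT x:\<Omega>|lebesgue. 2 * (U' x * U' x - U' x * U x))"
    using set_integral_diff(2)[OF int_U int_wd] by simp

  have int_e: "set_integrable lebesgue \<Omega> (\<lambda>x. \<epsilon>\<^sup>2 / 2 * (norm (gradient u x))\<^sup>2 + (Y x)\<^sup>2)"
    if "u \<in> V" "L2 \<Omega> Y" for u Y
    using integrable_gradients[OF that(1,1)] that(2)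
    by (intro set_integral_add(1) set_integrable_mult_right) (auto simp: L2_def dot_square_norm)
  have int_g: "set_integrable lebesgue \<Omega> (\<lambda>x. \<epsilon>\<^sup>2 * (gradient ?d x \<bullet> gradient \<phi>' x))"
    using integrable_gradients[OF V(3,1)] by simp
  have "energy \<Omega> \<epsilon> \<phi>' U' - energy \<Omega> \<epsilon> \<phi> U
      = (LINT x:\<Omega>|lebesgue. (\<epsilon>\<^sup>2 / 2 * (norm (gradient \<phi>' x))\<^sup>2 + (U' x)\<^sup>2)
          - (\<epsilon>\<^sup>2 / 2 * (norm (gradient \<phi> x))\<^sup>2 + (U x)\<^sup>2))"
    unfolding energy_def using int_e[OF V(1) reg(5)] int_e[OF reg(1,4)] by simp
  also have "\<dots> \<le> (LINT x:\<Omega>|lebesgue. \<epsilon>\<^sup>2 * (gradient ?d x \<bullet> gradient \<phi>' x)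
      + 2 * (U' x * U' x - U' x * U x))"
  proof (rule set_integral_mono)
    fix x assume x: "x \<in> \<Omega>"
    let ?p = "gradient \<phi>' x" and ?q = "gradient \<phi> x"
    have "0 \<le> \<epsilon>\<^sup>2 / 2 * (norm (?p - ?q))\<^sup>2 + (U' x - U x)\<^sup>2"
      by simp
    also have "\<dots> = (\<epsilon>\<^sup>2 * ((?p - ?q) \<bullet> ?p) + 2 * (U' x * U' x - U' x * U x))
        - ((\<epsilon>\<^sup>2 / 2 * (norm ?p)\<^sup>2 + (U' x)\<^sup>2) - (\<epsilon>\<^sup>2 / 2 * (norm ?q)\<^sup>2 + (U x)\<^sup>2))"
      unfolding power2_norm_eq_inner inner_diff_left inner_diff_right inner_commute[of ?q ?p]
      by (simp add: power2_eq_square field_simps)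
    finally show "(\<epsilon>\<^sup>2 / 2 * (norm ?p)\<^sup>2 + (U' x)\<^sup>2) - (\<epsilon>\<^sup>2 / 2 * (norm ?q)\<^sup>2 + (U x)\<^sup>2)
        \<le> \<epsilon>\<^sup>2 * (gradient ?d x \<bullet> ?p) + 2 * (U' x * U' x - U' x * U x)"
      unfolding grad_d[OF x] by simp
  qed (intro set_integral_diff(1) set_integral_add(1) int_e V reg int_g int_U)+
  also have "\<dots> = (LINT x:\<Omega>|lebesgue. w x * ?d x)"
    using 2 set_integral_add(2)[OF int_g int_U] by simp
  also have "\<dots> = - (\<tau> * M * (L2_norm \<Omega> (gradient w))\<^sup>2)"
  proof -
    have "(LINT x:\<Omega>|lebesgue. (norm (gradient w x))\<^sup>2) \<ge> 0"
      unfolding set_lebesgue_integral_def by (intro integral_nonneg_AE) simp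
    then show ?thesis
      using 1 by (simp add: L2_norm_def dot_square_norm)
  qed
  finally show ?thesis by simp
qed

end

lemma periodic_green_boundary_conditions:
  fixes a b :: "real ^ 'n"
  assumes "\<And>i. a $ i < b $ i"
  shows "green_boundary_conditions (box a b)
    {v. C1_on UNIV v \<and> cell_periodic (b - a) v} {v. C2_on UNIV v \<and> cell_periodic (b - a) v}"
proof
  fix v assume v: "v \<in> {v. C1_on UNIV v \<and> cell_periodic (b - a) v}"
  then have "continuous_on (closure (box a b)) v" "continuous_on (closure (box a b)) (gradient v)"
    by (auto intro: continuous_on_subset C1_on_continuous C1_on_continuous_gradient)
  then have "C1_closure (box a b) v"
    using v C1_on_subset[of UNIV v "box a b"] by (auto simp: C1_closure_def)
  then show "\<exists>C. \<forall>x\<in>box a b. \<bar>v x\<bar> \<le> C \<and> norm (gradient v x) \<le> C"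
    by (intro C1_closure_bounded bounded_box)
qed (use green_identity_periodic[OF assms] C1_on_diff C1_on_subset[OF _ subset_UNIV] in
      \<open>auto simp: C2_on_def cell_periodic_def\<close>)

lemma neumann_green_boundary_conditions:
  assumes "piecewise_C1_domain \<Omega>"
  shows "green_boundary_conditions \<Omega> {v. C1_closure \<Omega> v}
    {v. C2_on \<Omega> v \<and> C1_closure \<Omega> v \<and> homogeneous_neumann \<Omega> v}"
proof
  show "open \<Omega>" "bounded \<Omega>"
    using assms by (auto simp: piecewise_C1_domain_def)
  then show "\<exists>C. \<forall>x\<in>\<Omega>. \<bar>v x\<bar> \<le> C \<and> norm (gradient v x) \<le> C" if "v \<in> {v. C1_closure \<Omega> v}" for v
    using C1_closure_bounded that by blast
  show "C1_on \<Omega> v" if "v \<in> {v. C1_closure \<Omega> v}" for v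
    using that by (simp add: C1_closure_def)
qed (use green_identity_neumann[OF assms] C1_closure_diff in auto)

theorem theorem3p1:
  fixes \<Omega> :: "(real ^ 'n) set"
    and F :: "real \<Rightarrow> real" and D :: "real set"
    and A B M \<epsilon> \<delta>t :: real
    and \<phi> w U :: "nat \<Rightarrow> real ^ 'n \<Rightarrow> real"
    and n :: nat
  assumes dim: "CARD('n) = 2 \<or> CARD('n) = 3"
    and params: "M > 0" "\<epsilon> > 0" "\<delta>t > 0" "A > 0" "B > A"
    and potential: "open D" "F differentiable_on D" "\<forall>s\<in>D. F s > - A"
    and range: "\<forall>x\<in>\<Omega>. \<phi> n x \<in> D"
    and finite_energy: "L2 \<Omega> (U n)" "L2 \<Omega> (U (Suc n))"
    and scheme_phi:
      "\<forall>x\<in>\<Omega>. (\<phi> (Suc n) x - \<phi> n x) / \<delta>t - M * laplacian (w (Suc n)) x = 0"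
    and scheme_w:
      "\<forall>x\<in>\<Omega>. w (Suc n) x = - (\<epsilon>\<^sup>2 * laplacian (\<phi> (Suc n)) x) + H F B (\<phi> n x) * U (Suc n) x"
    and scheme_U:
      "\<forall>x\<in>\<Omega>. U (Suc n) x - U n x = 1 / 2 * H F B (\<phi> n x) * (\<phi> (Suc n) x - \<phi> n x)"
    and boundary:
      "(\<exists>a b. \<Omega> = box a b \<and> (\<forall>i. a $ i < b $ i) \<and>
          C1_on UNIV (\<phi> n) \<and> C2_on UNIV (\<phi> (Suc n)) \<and> C2_on UNIV (w (Suc n)) \<and>
          cell_periodic (b - a) (\<phi> n) \<and>
          cell_periodic (b - a) (\<phi> (Suc n)) \<and> cell_periodic (b - a) (w (Suc n))) \<or>
       (piecewise_C1_domain \<Omega> \<and>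
          C1_closure \<Omega> (\<phi> n) \<and>
          C2_on \<Omega> (\<phi> (Suc n)) \<and> C1_closure \<Omega> (\<phi> (Suc n)) \<and>
          C2_on \<Omega> (w (Suc n)) \<and> C1_closure \<Omega> (w (Suc n)) \<and>
          homogeneous_neumann \<Omega> (\<phi> (Suc n)) \<and> homogeneous_neumann \<Omega> (w (Suc n)))"
  shows "energy \<Omega> \<epsilon> (\<phi> (Suc n)) (U (Suc n))
           \<le> energy \<Omega> \<epsilon> (\<phi> n) (U n) - \<delta>t * M * (L2_norm \<Omega> (gradient (w (Suc n))))\<^sup>2"
proof -
  obtain V W where "green_boundary_conditions \<Omega> V W"
    and reg: "\<phi> n \<in> V" "\<phi> (Suc n) \<in> W" "w (Suc n) \<in> W"
    using boundary
  proof (elim disjE exE conjE, goal_cases)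
    case (1 a b)
    show ?case
      by (rule 1(1)) (use 1 periodic_green_boundary_conditions[of a b] in auto)
  next
    case 2
    show ?case
      by (rule 2(1)) (use 2 neumann_green_boundary_conditions in auto)
  qed
  then interpret green_boundary_conditions \<Omega> V W by simp
  show ?thesis
    by (rule energy_dissipation[where h = "\<lambda>x. H F B (\<phi> n x)"])
       (use params reg finite_energy scheme_phi scheme_w scheme_U in auto)
qed

end
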